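(* Let $\lambda_A,\lambda_B,\lambda_C>0$. In the stationary regime of the two-zone 1v1 matchmaking system with FIFO service order, in which players for Zone A only, players for Zone B only, and choice-free players (for both zones) arrive at rates $\lambda_A,\lambda_B,\lambda_C$ respectively, let $T_A,T_B,T_C$ denote the waiting times of these three types of players, let $T$ denote the waiting time of a generic player (of any type), and let $\pi_0$ be the stationary probability that no player is waiting in either zone. Then $$\mathbb{E}[T_A]=\frac{2\lambda_A\lambda_B+\lambda_A\lambda_C+2\lambda_B^2+4\lambda_B\lambda_C+\lambda_C^2}{(\lambda_A+\lambda_C)(\lambda_B+\lambda_C)(\lambda_A+\lambda_B+\lambda_C)}\,\pi_0,$$ $$\mathbb{E}[T_B]=\frac{2\lambda_A\lambda_B+\lambda_B\lambda_C+2\lambda_A^2+4\lambda_A\lambda_C+\lambda_C^2}{(\lambda_A+\lambda_C)(\lambda_B+\lambda_C)(\lambda_A+\lambda_B+\lambda_C)}\,\pi_0,$$ $$\mathbb{E}[T_C]=\frac{\pi_0}{\lambda_A+\lambda_B+\lambda_C},$$ and $$\mathbb{E}[T]=\frac{\lambda_A\mathbb{E}[T_A]+\lambda_B\mathbb{E}[T_B]+\lambda_C\mathbb{E}[T_C]}{\lambda_A+\lambda_B+\lambda_C}.$$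
   Context: Model: a 1v1 game is offered in two zones, A (junior) and B (advanced). Three types of players arrive as independent Poisson processes: players who play only in Zone A (rate $\lambda_A$), players who play only in Zone B (rate $\lambda_B$), and choice-free players who join both queues and play in either zone (rate $\lambda_C$). Two players are matched, and leave instantaneously, as soon as there is a zone in which both can play. If a choice-free player arrives when one Zone-A player and one Zone-B player are waiting, it is matched with whichever of the two arrived first (FIFO). The system is a continuous-time Markov chain with six states: $0$ (nobody waiting); $A$, $B$, $C$ (exactly one player waiting, of type A, type B, or choice-free, respectively); $AB$ (one type-A and one type-B player waiting, the type-A player having arrived first); $BA$ (the same, with the type-B player having arrived first). The transition rates are: $0\to A$, $0\to B$, $0\to C$ at rates $\lambda_A,\lambda_B,\lambda_C$; $A\to0$ at rate $\lambda_A+\lambda_C$; $A\to AB$ at rate $\lambda_B$; $B\to0$ at rate $\lambda_B+\lambda_C$; $B\to BA$ at rate $\lambda_A$; $AB\to B$ at rate $\lambda_A+\lambda_C$; $AB\to A$ at rate $\lambda_B$; $BA\to A$ at rate $\lambda_B+\lambda_C$; $BA\to B$ at rate $\lambda_A$; $C\to0$ at rate $\lambda_A+\lambda_B+\lambda_C$. The waiting time of a player is the time from its arrival until it is matched (zero if it is matched on arrival). A generic player is of type A, B, or choice-free with probability proportional to $\lambda_A,\lambda_B,\lambda_C$. *)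

theory Defs
  imports "HOL-Probability.Probability"
begin

section \<open>Players, zones and the FIFO matching rule\<close>

datatype zone = ZoneA | ZoneB

datatype ptype = TypeA | TypeB | TypeC

fun plays_in :: "ptype \<Rightarrow> zone set" where
  "plays_in TypeA = {ZoneA}"
| "plays_in TypeB = {ZoneB}"
| "plays_in TypeC = {ZoneA, ZoneB}"

definition can_match :: "ptype \<Rightarrow> ptype \<Rightarrow> bool" where
  "can_match p q \<longleftrightarrow> plays_in p \<inter> plays_in q \<noteq> {}"

text \<open>A queue lists the waiting players in order of arrival. Each carries an identity, so that an
  individual player can be followed until it is matched. An arriving player is matched with the
  longest-waiting compatible player (both leave at once); if there is none, it joins the queue.\<close>

fun admit :: "ptype \<times> 'i \<Rightarrow> (ptype \<times> 'i) list \<Rightarrow> (ptype \<times> 'i) list" where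
  "admit p [] = [p]"
| "admit p (q # qs) = (if can_match (fst p) (fst q) then qs else q # admit p qs)"


section \<open>The six-state Markov chain\<close>

datatype state = S0 | SA | SB | SC | SAB | SBA

fun waiting :: "state \<Rightarrow> ptype list" where
  "waiting S0 = []"
| "waiting SA = [TypeA]"
| "waiting SB = [TypeB]"
| "waiting SC = [TypeC]"
| "waiting SAB = [TypeA, TypeB]"
| "waiting SBA = [TypeB, TypeA]"

fun arrival_rate :: "real \<Rightarrow> real \<Rightarrow> real \<Rightarrow> ptype \<Rightarrow> real" where
  "arrival_rate lA lB lC TypeA = lA"
| "arrival_rate lA lB lC TypeB = lB"
| "arrival_rate lA lB lC TypeC = lC"

fun trans_rate :: "real \<Rightarrow> real \<Rightarrow> real \<Rightarrow> state \<Rightarrow> state \<Rightarrow> real" where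
  "trans_rate lA lB lC S0 SA = lA"
| "trans_rate lA lB lC S0 SB = lB"
| "trans_rate lA lB lC S0 SC = lC"
| "trans_rate lA lB lC SA S0 = lA + lC"
| "trans_rate lA lB lC SA SAB = lB"
| "trans_rate lA lB lC SB S0 = lB + lC"
| "trans_rate lA lB lC SB SBA = lA"
| "trans_rate lA lB lC SAB SB = lA + lC"
| "trans_rate lA lB lC SAB SA = lB"
| "trans_rate lA lB lC SBA SA = lB + lC"
| "trans_rate lA lB lC SBA SB = lA"
| "trans_rate lA lB lC SC S0 = lA + lB + lC"
| "trans_rate lA lB lC _ _ = 0"

text \<open>The rate table is the one induced by the matching rule.\<close>

lemma trans_rate_admit:
  "trans_rate lA lB lC x y =
    (\<Sum>p\<leftarrow>[TypeA, TypeB, TypeC].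
       if map fst (admit (p, i) (map (\<lambda>q. (q, i)) (waiting x))) = waiting y
       then arrival_rate lA lB lC p else 0)"
  by (cases x; cases y) (simp_all add: can_match_def)

definition stationary_distribution :: "real \<Rightarrow> real \<Rightarrow> real \<Rightarrow> state pmf \<Rightarrow> bool" where
  "stationary_distribution lA lB lC \<pi> \<longleftrightarrow>
     (\<forall>y. (\<Sum>x\<in>UNIV. pmf \<pi> x * trans_rate lA lB lC x y)
          = pmf \<pi> y * (\<Sum>z\<in>UNIV. trans_rate lA lB lC y z))"


section \<open>Sample paths\<close>

text \<open>Below, \<open>t p n\<close> is the \<open>n\<close>-th (counted from 0) interarrival time of the type-\<open>p\<close> players, and
  \<open>s\<close> is the state at time 0.\<close>

definition arrival_time :: "(ptype \<Rightarrow> nat \<Rightarrow> real) \<Rightarrow> ptype \<Rightarrow> nat \<Rightarrow> real" where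
  "arrival_time t p n = (\<Sum>i\<le>n. t p i)"

text \<open>The three arrival streams are merged in chronological order. If \<open>c p\<close> players of each
  type \<open>p\<close> have arrived so far, \<open>next_type t c\<close> is the type of the next one; ties have probability
  zero and are broken arbitrarily.\<close>

definition next_type :: "(ptype \<Rightarrow> nat \<Rightarrow> real) \<Rightarrow> (ptype \<Rightarrow> nat) \<Rightarrow> ptype" where
  "next_type t c =
     (let a = arrival_time t TypeA (c TypeA);
          b = arrival_time t TypeB (c TypeB);
          d = arrival_time t TypeC (c TypeC)
      in if a \<le> b \<and> a \<le> d then TypeA else if b \<le> d then TypeB else TypeC)"

primrec arrived :: "(ptype \<Rightarrow> nat \<Rightarrow> real) \<Rightarrow> nat \<Rightarrow> ptype \<Rightarrow> nat" where
  "arrived t 0 = (\<lambda>_. 0)"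
| "arrived t (Suc k) =
     (let c = arrived t k; p = next_type t c in c(p := Suc (c p)))"

text \<open>Type and arrival time of player \<open>k\<close>, the \<open>k\<close>-th player (counted from 0) of any type to arrive
  after time 0.\<close>

definition player_type :: "(ptype \<Rightarrow> nat \<Rightarrow> real) \<Rightarrow> nat \<Rightarrow> ptype" where
  "player_type t k = next_type t (arrived t k)"

definition player_time :: "(ptype \<Rightarrow> nat \<Rightarrow> real) \<Rightarrow> nat \<Rightarrow> real" where
  "player_time t k = arrival_time t (player_type t k) (arrived t k (player_type t k))"

text \<open>\<open>queue t s k\<close> is the queue after the first \<open>k\<close> arrivals; player \<open>k\<close> has identity \<open>Some k\<close>, and
  the players already waiting at time 0 have identity \<open>None\<close>.\<close>

primrec queue :: "(ptype \<Rightarrow> nat \<Rightarrow> real) \<Rightarrow> state \<Rightarrow> nat \<Rightarrow> (ptype \<times> nat option) list" where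
  "queue t s 0 = map (\<lambda>p. (p, None)) (waiting s)"
| "queue t s (Suc k) = admit (player_type t k, Some k) (queue t s k)"

text \<open>Matches happen at arrivals only, so player \<open>k\<close> is matched at the first arrival \<open>m \<ge> k\<close> that
  leaves it outside the queue (\<open>m = k\<close> if it is matched on arrival). The infimum is attained there,
  as arrival times increase with \<open>m\<close>; a player that is never matched waits for infinite time.\<close>

definition waiting_time :: "(ptype \<Rightarrow> nat \<Rightarrow> real) \<Rightarrow> state \<Rightarrow> nat \<Rightarrow> ennreal" where
  "waiting_time t s k =
     (INF m \<in> {m. k \<le> m \<and> Some k \<notin> snd ` set (queue t s (Suc m))}.
        ennreal (player_time t m - player_time t k))"


section \<open>The stationary system\<close>

text \<open>The arrival streams are independent Poisson processes (independent exponential interarrival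
  times), independent of the state at time 0, which has the stationary distribution.\<close>

locale stationary_matchmaking = prob_space M
  for M :: "'w measure" +
  fixes lA lB lC :: real
    and \<pi> :: "state pmf"
    and X0 :: "'w \<Rightarrow> state"
    and \<tau> :: "ptype \<Rightarrow> nat \<Rightarrow> 'w \<Rightarrow> real"
  assumes rates_pos: "0 < lA" "0 < lB" "0 < lC"
    and stationary: "stationary_distribution lA lB lC \<pi>"
    and X0_measurable: "X0 \<in> measurable M (count_space UNIV)"
    and X0_distr: "distr M (count_space UNIV) X0 = measure_pmf \<pi>"
    and exponential:
      "\<And>p n. distributed M lborel (\<tau> p n) (exponential_density (arrival_rate lA lB lC p))"
    and indep_interarrival:
      "indep_vars (\<lambda>_. borel) (\<lambda>(p, n). \<tau> p n) (UNIV :: (ptype \<times> nat) set)"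
    and indep_initial:
      "indep_set
         (sets (vimage_algebra (space M) X0 (count_space UNIV)))
         (sets (vimage_algebra (space M) (\<lambda>\<omega> (p, n). \<tau> p n \<omega>)
            (Pi\<^sub>M (UNIV :: (ptype \<times> nat) set) (\<lambda>_. borel))))"

text \<open>Mean waiting time of player \<open>k\<close>, without regard to its type and conditionally on its type
  being \<open>p\<close>, respectively.\<close>

definition mean_wait ::
  "'w measure \<Rightarrow> ('w \<Rightarrow> state) \<Rightarrow> (ptype \<Rightarrow> nat \<Rightarrow> 'w \<Rightarrow> real) \<Rightarrow> nat \<Rightarrow> ennreal" where
  "mean_wait M X0 \<tau> k = (\<integral>\<^sup>+\<omega>. waiting_time (\<lambda>p n. \<tau> p n \<omega>) (X0 \<omega>) k \<partial>M)"

definition mean_wait_of ::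
  "'w measure \<Rightarrow> ('w \<Rightarrow> state) \<Rightarrow> (ptype \<Rightarrow> nat \<Rightarrow> 'w \<Rightarrow> real) \<Rightarrow> ptype \<Rightarrow> nat \<Rightarrow> ennreal" where
  "mean_wait_of M X0 \<tau> p k =
     (\<integral>\<^sup>+\<omega>. waiting_time (\<lambda>p n. \<tau> p n \<omega>) (X0 \<omega>) k
        \<partial>uniform_measure M {\<omega> \<in> space M. player_type (\<lambda>p n. \<tau> p n \<omega>) k = p})"

end

theory Submission
  imports Defs
begin

text \<open>In every state the transition rates add up to the total arrival rate. Hence the stationary
  distribution of the chain is also the one seen by each arriving player. By memorylessness, after
  the first arrival the three streams start afresh: the type of that arrival, its time and the
  restarted streams are independent, the streams having the original law. This moves player
  \<open>k + 1\<close> to player \<open>k\<close>, and turns the mean residual waiting times of a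
  waiting player into the solution of a linear system. The system is solved for residual times
  capped at \<open>N\<close> first, where all quantities are finite, which excludes the solution
  \<open>\<infinity>\<close>.\<close>

text \<open>The merged arrival sequence is defined through counters on three streams, so the restart
  is first proved path by path: \<open>waiting_time_Suc\<close> and \<open>waiting_time_0\<close>
  hold for every \<open>t\<close>, ties and negative entries included. Only the recursion for
  residual times needs nonnegative interarrival times, which hold almost surely. Probability enters
  through a single identity, the race of three exponential clocks. The constants come from FIFO. A
  single-zone player of type \<open>p\<close> at the front leaves at the next arrival of type
  \<open>p\<close> or \<open>TypeC\<close>, whatever stands behind it, so its mean residual time is
  \<open>1 / (rate p + rate TypeC)\<close>. Behind a player of the other zone it first waits one gap
  of mean \<open>1 / total\<close>, after which it is either matched or at the front. A type-A
  player has to wait only if it finds \<open>S0\<close> or \<open>SB\<close>, so its mean combines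
  these two values with weights \<open>pmf \<pi> S0\<close> and \<open>pmf \<pi> SB\<close>. The
  latter is a multiple of the former, which is why only the probability of the empty system is left
  in the formulas.\<close>

section \<open>Integration over product measures, and memorylessness of the exponential law\<close>

text \<open>Overwriting one coordinate by an independent copy with the same law preserves the
  product measure. This isolates a single interarrival time as an outer integration
  variable.\<close>

lemma nn_integral_PiM_resample:
  fixes N :: "'i \<Rightarrow> 'a measure"
  assumes N: "\<And>i. prob_space (N i)"
    and F [measurable]: "F \<in> borel_measurable (PiM UNIV N)"
  shows "(\<integral>\<^sup>+w. F w \<partial>PiM UNIV N) = (\<integral>\<^sup>+x. \<integral>\<^sup>+w. F (w(i := x)) \<partial>PiM UNIV N \<partial>N i)"
proof -
  interpret P: prob_space "PiM UNIV N"
    by (intro prob_space_PiM N)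
  have [measurable]: "(\<lambda>(x, w). w(i := x)) \<in> measurable (N i \<Otimes>\<^sub>M PiM UNIV N) (PiM UNIV N)"
    using measurable_fun_upd[of UNIV UNIV i "\<lambda>z. snd z" "N i \<Otimes>\<^sub>M PiM UNIV N" N "\<lambda>z. fst z"]
    by (simp add: case_prod_unfold)
  have "PiM UNIV N = distr (N i \<Otimes>\<^sub>M PiM UNIV N) (PiM UNIV N) (\<lambda>(x, w). w(i := x))"
    using distr_pair_PiM_eq_PiM[of UNIV N i] N by simp
  then have "(\<integral>\<^sup>+w. F w \<partial>PiM UNIV N) =
      (\<integral>\<^sup>+w. F w \<partial>distr (N i \<Otimes>\<^sub>M PiM UNIV N) (PiM UNIV N) (\<lambda>(x, w). w(i := x)))"
    by simp
  also have "\<dots> = (\<integral>\<^sup>+z. F (case z of (x, w) \<Rightarrow> w(i := x)) \<partial>(N i \<Otimes>\<^sub>M PiM UNIV N))"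
    by (subst nn_integral_distr) auto
  also have "\<dots> = (\<integral>\<^sup>+x. \<integral>\<^sup>+w. F (w(i := x)) \<partial>PiM UNIV N \<partial>N i)"
    by (subst P.nn_integral_fst[symmetric]) auto
  finally show ?thesis .
qed

text \<open>Selecting distinct coordinates with matching factors reproduces the product law. It is
  applied to the injection that drops the first interarrival time of one stream.\<close>

lemma nn_integral_PiM_reindex:
  fixes N :: "'i \<Rightarrow> 'a measure"
  assumes N: "\<And>i. prob_space (N i)"
    and f: "inj f" "\<And>i. N (f i) = N i"
    and F [measurable]: "F \<in> borel_measurable (PiM UNIV N)"
  shows "(\<integral>\<^sup>+w. F (\<lambda>i. w (f i)) \<partial>PiM UNIV N) = (\<integral>\<^sup>+w. F w \<partial>PiM UNIV N)"
proof -
  have [measurable]: "(\<lambda>w i. w (f i)) \<in> measurable (PiM UNIV N) (PiM UNIV N)"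
  proof (rule measurable_PiM_single')
    fix i show "(\<lambda>w. w (f i)) \<in> measurable (PiM UNIV N) (N i)"
      using measurable_component_singleton[of "f i" UNIV N] by (simp add: f)
  qed (use f(2) in \<open>auto simp: space_PiM PiE_iff, metis\<close>)
  have "distr (PiM UNIV N) (PiM UNIV N) (\<lambda>w i. w (f i)) = PiM UNIV N"
    using distr_PiM_reindex[of UNIV N f UNIV] N f by (simp add: restrict_UNIV)
  then have "(\<integral>\<^sup>+w. F w \<partial>PiM UNIV N) =
      (\<integral>\<^sup>+w. F w \<partial>distr (PiM UNIV N) (PiM UNIV N) (\<lambda>w i. w (f i)))"
    by simp
  also have "\<dots> = (\<integral>\<^sup>+w. F (\<lambda>i. w (f i)) \<partial>PiM UNIV N)"
    by (subst nn_integral_distr) auto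
  finally show ?thesis ..
qed

abbreviation exponential :: "real \<Rightarrow> real measure" where
  "exponential l \<equiv> density lborel (\<lambda>x. ennreal (exponential_density l x))"

text \<open>The relation \<open>L\<close> covers both ways of breaking a tie, which has probability zero.\<close>

lemma nn_integral_exponential_memoryless:
  fixes h :: "real \<Rightarrow> ennreal"
  assumes l: "0 < l" and x: "0 \<le> x"
    and h [measurable]: "h \<in> borel_measurable borel"
    and L: "\<And>y. x < y \<Longrightarrow> L y" "\<And>y. L y \<Longrightarrow> x \<le> y"
  shows "(\<integral>\<^sup>+y. (if L y then h (y - x) else 0) \<partial>exponential l) =
           ennreal (exp (- (l * x))) * (\<integral>\<^sup>+y. h y \<partial>exponential l)"
proof -
  have "AE y in lborel. 0 < ennreal (exponential_density l y) \<longrightarrow>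
      (if L y then h (y - x) else 0) = (if x \<le> y then h (y - x) else 0)"
    using AE_lborel_singleton[of x]
  proof eventually_elim
    case (elim y)
    then have "L y \<longleftrightarrow> x \<le> y"
      using L[of y] by (auto simp: less_le)
    then show ?case by simp
  qed
  then have "AE y in exponential l. (if L y then h (y - x) else 0) = (if x \<le> y then h (y - x) else 0)"
    by (subst AE_density) simp_all
  then have "(\<integral>\<^sup>+y. (if L y then h (y - x) else 0) \<partial>exponential l) =
      (\<integral>\<^sup>+y. (if x \<le> y then h (y - x) else 0) \<partial>exponential l)"
    by (rule nn_integral_cong_AE)
  also have "\<dots> = (\<integral>\<^sup>+y. ennreal (exponential_density l y) * (if x \<le> y then h (y - x) else 0) \<partial>lborel)"
    by (subst nn_integral_density) auto
  also have "\<dots> = (\<integral>\<^sup>+y. ennreal (exponential_density l (x + 1 * y)) *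
                     (if x \<le> x + 1 * y then h (x + 1 * y - x) else 0) \<partial>lborel)"
    by (subst nn_integral_real_affine[where c = 1 and t = x]) auto
  also have "\<dots> = (\<integral>\<^sup>+y. ennreal (exp (- (l * x))) * (ennreal (exponential_density l y) * h y) \<partial>lborel)"
  proof (rule nn_integral_cong)
    fix y :: real
    have "exponential_density l (x + y) = exp (- (l * x)) * exponential_density l y" if "0 \<le> y"
      using that x by (simp add: exponential_density_def exp_add[symmetric] algebra_simps)
    moreover have "exponential_density l y = 0" if "\<not> 0 \<le> y"
      using that by (simp add: exponential_density_def)
    ultimately show "ennreal (exponential_density l (x + 1 * y)) *
        (if x \<le> x + 1 * y then h (x + 1 * y - x) else 0) =
      ennreal (exp (- (l * x))) * (ennreal (exponential_density l y) * h y)"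
      by (cases "0 \<le> y") (simp_all add: ennreal_mult' mult.assoc)
  qed
  also have "\<dots> = ennreal (exp (- (l * x))) * (\<integral>\<^sup>+y. ennreal (exponential_density l y) * h y \<partial>lborel)"
    by (rule nn_integral_cmult) auto
  also have "(\<integral>\<^sup>+y. ennreal (exponential_density l y) * h y \<partial>lborel) = (\<integral>\<^sup>+y. h y \<partial>exponential l)"
    by (subst nn_integral_density) auto
  finally show ?thesis .
qed

lemma nn_integral_exponential_ident:
  assumes "0 < l"
  shows "(\<integral>\<^sup>+x. ennreal x \<partial>exponential l) = ennreal (1 / l)"
proof -
  have "(\<integral>\<^sup>+x. ennreal x \<partial>exponential l) =
      (\<integral>\<^sup>+x. ennreal (exponential_density l x * x ^ 1) \<partial>lborel)"
    using assms
    by (subst nn_integral_density)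
       (auto intro!: nn_integral_cong simp: exponential_density_def ennreal_mult')
  then show ?thesis
    using nn_integral_erlang_ith_moment[OF assms, of 0 1] by simp
qed


section \<open>Restarting the arrival streams at the first arrival\<close>

definition first :: "(ptype \<Rightarrow> nat \<Rightarrow> real) \<Rightarrow> ptype" where
  "first t = next_type t (\<lambda>_. 0)"

definition gap :: "(ptype \<Rightarrow> nat \<Rightarrow> real) \<Rightarrow> real" where
  "gap t = t (first t) 0"

text \<open>The clock is set to zero at the first arrival: the winning stream loses its first entry,
  while each losing stream keeps its pending arrival with only the residual time left.\<close>

definition restart :: "(ptype \<Rightarrow> nat \<Rightarrow> real) \<Rightarrow> ptype \<Rightarrow> nat \<Rightarrow> real" where
  "restart t q n =
     (if q = first t then t q (Suc n) else if n = 0 then t q 0 - gap t else t q n)"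

lemma first_def': "first t =
    (if t TypeA 0 \<le> t TypeB 0 \<and> t TypeA 0 \<le> t TypeC 0 then TypeA
     else if t TypeB 0 \<le> t TypeC 0 then TypeB else TypeC)"
  by (simp add: first_def next_type_def arrival_time_def Let_def)

lemma gap_le: "gap t \<le> t p 0"
  by (cases p) (auto simp: gap_def first_def')

lemma restart_nonneg: "(\<And>p n. 0 \<le> t p n) \<Longrightarrow> 0 \<le> restart t p n"
  using gap_le[of t p] by (simp add: restart_def)

text \<open>For the winner the removed first term is exactly the gap; for a loser the gap was
  subtracted from the first term. In both cases the partial sums differ by the gap.\<close>

lemma arrival_time_restart:
  "arrival_time t q (if q = first t then Suc n else n) = gap t + arrival_time (restart t) q n"
proof (induction n)
  case 0
  show ?case by (simp add: arrival_time_def restart_def gap_def)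
next
  case (Suc n)
  then show ?case
    by (cases "q = first t") (simp_all add: arrival_time_def restart_def)
qed

text \<open>Translates counts for the restarted streams back to counts for the original ones. The
  conditional form is the index pattern of \<open>arrival_time_restart\<close>.\<close>

definition arrived_after :: "ptype \<Rightarrow> (ptype \<Rightarrow> nat) \<Rightarrow> ptype \<Rightarrow> nat" where
  "arrived_after p c q = (if q = p then Suc (c q) else c q)"

lemma arrival_time_arrived_after:
  "arrival_time t q (arrived_after (first t) c q) = gap t + arrival_time (restart t) q (c q)"
  unfolding arrived_after_def by (rule arrival_time_restart)

text \<open>All three compared times are shifted by the same gap, so every comparison has the same
  outcome, also at ties.\<close>

lemma next_type_restart:
  "next_type t (arrived_after (first t) c) = next_type (restart t) c"
  unfolding next_type_def Let_def arrival_time_arrived_after add_le_cancel_left ..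

lemma arrived_Suc_restart: "arrived t (Suc k) = arrived_after (first t) (arrived (restart t) k)"
proof (induction k)
  case 0
  show ?case by (auto simp: arrived_after_def first_def Let_def)
next
  case (Suc k)
  let ?c = "arrived (restart t) k"
  let ?p = "next_type (restart t) ?c"
  have "arrived t (Suc (Suc k)) =
      (arrived_after (first t) ?c)(?p := Suc (arrived_after (first t) ?c ?p))"
    unfolding arrived.simps(2)[of t "Suc k"] Let_def Suc next_type_restart ..
  also have "\<dots> = arrived_after (first t) (?c(?p := Suc (?c ?p)))"
    by (auto simp: arrived_after_def)
  also have "?c(?p := Suc (?c ?p)) = arrived (restart t) (Suc k)"
    by (simp add: Let_def)
  finally show ?case .
qed

lemma player_type_0: "player_type t 0 = first t"
  by (simp add: player_type_def first_def)

lemma player_type_Suc: "player_type t (Suc k) = player_type (restart t) k"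
  unfolding player_type_def arrived_Suc_restart next_type_restart ..

lemma player_time_0: "player_time t 0 = gap t"
  by (simp add: player_time_def player_type_0 arrival_time_def gap_def)

lemma player_time_Suc: "player_time t (Suc k) = gap t + player_time (restart t) k"
  unfolding player_time_def player_type_Suc arrived_Suc_restart arrival_time_arrived_after ..

lemma player_time_nonneg: "(\<And>p n. 0 \<le> t p n) \<Longrightarrow> 0 \<le> player_time t k"
  by (simp add: player_time_def arrival_time_def sum_nonneg)


section \<open>The waiting time as a residual time\<close>

text \<open>Generalises \<open>queue\<close> to an arbitrary initial queue and arbitrary labels
  \<open>l\<close>: a restart shifts the numbering of the players, and a residual time needs only
  Boolean labels.\<close>

primrec queue_from ::
  "(ptype \<Rightarrow> nat \<Rightarrow> real) \<Rightarrow> (nat \<Rightarrow> 'i) \<Rightarrow> (ptype \<times> 'i) list \<Rightarrow> nat \<Rightarrow> (ptype \<times> 'i) list"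
where
  "queue_from t l q 0 = q"
| "queue_from t l q (Suc k) = admit (player_type t k, l k) (queue_from t l q k)"

lemma queue_eq_queue_from: "queue t s k = queue_from t Some (map (\<lambda>p. (p, None)) (waiting s)) k"
  by (induction k) simp_all

lemma queue_from_restart:
  "queue_from t l q (Suc k) = queue_from (restart t) (\<lambda>k. l (Suc k)) (admit (first t, l 0) q) k"
  by (induction k) (simp_all add: player_type_0 player_type_Suc)

text \<open>Matching inspects only types, so relabelling identities commutes with it.\<close>

lemma map_admit: "map (map_prod id f) (admit (p, i) q) = admit (p, f i) (map (map_prod id f) q)"
  by (induction q) auto

lemma map_queue_from:
  "map (map_prod id f) (queue_from t l q k) =
     queue_from t (\<lambda>k. f (l k)) (map (map_prod id f) q) k"
  by (induction k) (simp_all only: queue_from.simps map_admit)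

text \<open>The players marked \<open>True\<close> are being followed. Later arrivals are not marked.\<close>

definition marked :: "(ptype \<times> bool) list \<Rightarrow> bool" where
  "marked q \<longleftrightarrow> True \<in> snd ` set q"

lemma marked_map: "marked (map (map_prod id f) q) \<longleftrightarrow> (\<exists>i \<in> snd ` set q. f i)"
  by (force simp: marked_def)

text \<open>Time is measured from 0, when the queue is \<open>q\<close>. The unmarked case is
  separate because the infimum alone would still charge the time until the next arrival to a player
  already gone.\<close>

definition residual :: "(ptype \<Rightarrow> nat \<Rightarrow> real) \<Rightarrow> (ptype \<times> bool) list \<Rightarrow> ennreal" where
  "residual t q =
     (if marked q
      then INF m. if marked (queue_from t (\<lambda>_. False) q (Suc m)) then \<top> else ennreal (player_time t m)
      else 0)"

text \<open>\<open>\<top>\<close> is neutral for infima, so a path-dependent index set becomes all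
  of \<open>nat\<close>. This form can be split at index 0 and is measurable as a countable
  infimum.\<close>

lemma INF_Collect_eq:
  fixes f :: "'a \<Rightarrow> 'b :: complete_lattice"
  shows "(INF m \<in> {m. P m}. f m) = (INF m. if P m then f m else \<top>)"
proof (rule antisym)
  show "(INF m \<in> {m. P m}. f m) \<le> (INF m. if P m then f m else \<top>)"
  proof (rule INF_greatest)
    show "(INF m \<in> {m. P m}. f m) \<le> (if P m then f m else \<top>)" for m
      by (simp add: INF_lower)
  qed
  show "(INF m. if P m then f m else \<top>) \<le> (INF m \<in> {m. P m}. f m)"
  proof (rule INF_greatest)
    fix m assume "m \<in> {m. P m}"
    then have "(if P m then f m else \<top>) \<le> f m" by simp
    then show "(INF m. if P m then f m else \<top>) \<le> f m"
      by (rule INF_lower2[OF UNIV_I])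
  qed
qed


lemma INF_nat_split:
  fixes f :: "nat \<Rightarrow> 'b :: complete_lattice"
  shows "(INF m. f m) = inf (f 0) (INF m. f (Suc m))"
  by (subst UNIV_nat_eq) (simp add: image_image)

text \<open>The first arrival is split off and the gap taken out of the remaining infimum.
  Nonnegativity is needed because \<open>ennreal\<close> truncates negative numbers and is additive
  only on nonnegative ones.\<close>

lemma residual_rec:
  assumes t: "\<And>p n. 0 \<le> t p n" and q: "marked q"
  shows "residual t q = ennreal (gap t) + residual (restart t) (admit (first t, False) q)"
proof -
  let ?q = "admit (first t, False) q"
  define g where "g m = (if marked (queue_from (restart t) (\<lambda>_. False) ?q (Suc m)) then \<top>
      else ennreal (player_time (restart t) m))" for m
  have "0 \<le> gap t"
    using t by (simp add: gap_def)
  have "residual t q = inf (if marked ?q then \<top> else ennreal (gap t))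
      (INF m. if marked (queue_from t (\<lambda>_. False) q (Suc (Suc m))) then \<top>
         else ennreal (player_time t (Suc m)))"
    using q unfolding residual_def
    by (subst INF_nat_split) (simp add: player_type_0 player_time_0)
  also have "(\<lambda>m. if marked (queue_from t (\<lambda>_. False) q (Suc (Suc m))) then \<top>
         else ennreal (player_time t (Suc m))) = (\<lambda>m. ennreal (gap t) + g m)"
    unfolding queue_from_restart[of t _ q] g_def player_time_Suc
    using \<open>0 \<le> gap t\<close> player_time_nonneg[OF restart_nonneg[OF t]] by (auto simp del: queue_from.simps)
  also have "(INF m. ennreal (gap t) + g m) = ennreal (gap t) + (INF m. g m)"
    by (rule INF_ennreal_const_add)
  \<comment> \<open>If the first arrival removes the mark, the term at index 0 is the gap and lies
    below all others, and the residual after the restart is 0; otherwise that term is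
    \<open>\<top>\<close> and drops out.\<close>
  finally show ?thesis
    by (auto simp: residual_def g_def inf_absorb1 simp del: queue_from.simps)
qed

lemma waiting_time_0:
  "waiting_time t s 0 = residual (restart t) (admit (first t, True) (map (\<lambda>p. (p, False)) (waiting s)))"
proof -
  let ?q = "admit (first t, True) (map (\<lambda>p. (p, False)) (waiting s))"
  let ?Q = "queue_from (restart t) (\<lambda>_. False) ?q"
  have marked_iff: "Some 0 \<in> snd ` set (queue t s (Suc m)) \<longleftrightarrow> marked (?Q m)" for m
  proof -
    \<comment> \<open>The relabelling marks player 0 and sends both the initial players
      (\<open>None\<close>) and all later arrivals to \<open>False\<close>.\<close>
    have eq: "map (map_prod id (\<lambda>i. i = Some 0)) (queue t s (Suc m)) = ?Q m"
      unfolding queue_eq_queue_from queue_from_restart map_queue_from map_admit by (simp add: o_def)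
    show ?thesis
      unfolding eq[symmetric] marked_map by metis
  qed
  have "waiting_time t s 0 =
      (INF m. if marked (?Q m) then \<top> else ennreal (player_time t m - player_time t 0))"
    unfolding waiting_time_def INF_Collect_eq marked_iff by (intro INF_cong) auto
  also have "\<dots> = inf (if marked ?q then \<top> else 0)
      (INF m. if marked (?Q (Suc m)) then \<top> else ennreal (player_time (restart t) m))"
    by (subst INF_nat_split) (simp add: player_time_Suc player_time_0 del: queue_from.simps(2))
  also have "\<dots> = residual (restart t) ?q"
    by (auto simp: residual_def inf_absorb1 simp del: queue_from.simps)
  finally show ?thesis .
qed

fun step :: "ptype \<Rightarrow> state \<Rightarrow> state" where
  "step TypeA S0 = SA" | "step TypeB S0 = SB" | "step TypeC S0 = SC"
| "step TypeB SA = SAB" | "step _ SA = S0"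
| "step TypeA SB = SBA" | "step _ SB = S0"
| "step _ SC = S0"
| "step TypeB SAB = SA" | "step _ SAB = SB"
| "step TypeA SBA = SB" | "step _ SBA = SA"

lemma admit_waiting:
  "admit (p, i) (map (\<lambda>p. (p, i)) (waiting s)) = map (\<lambda>p. (p, i)) (waiting (step p s))"
  by (cases p; cases s) (simp_all add: can_match_def)

text \<open>For player \<open>k + 1\<close> the first arrival matters only through the state it
  leaves behind: player 0, if it waits, becomes one of the initially waiting players.\<close>

lemma waiting_time_Suc: "waiting_time t s (Suc k) = waiting_time (restart t) (step (first t) s) k"
proof -
  \<comment> \<open>\<open>f\<close> shifts the numbering down by one and turns player 0 into an
    anonymous initial player.\<close>
  define f where "f i = (case i of Some (Suc k) \<Rightarrow> Some k | _ \<Rightarrow> None)" for i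
  have f [simp]: "f (Some (Suc k)) = Some k" "f (Some 0) = None" "f None = None" for k
    by (simp_all add: f_def)
  have f_eq: "f i = Some k \<longleftrightarrow> i = Some (Suc k)" for i
    by (auto simp: f_def split: option.splits nat.splits)
  have queue_eq: "map (map_prod id f) (queue t s (Suc m)) = queue (restart t) (step (first t) s) m" for m
    unfolding queue_eq_queue_from queue_from_restart map_queue_from map_admit
    by (simp add: o_def admit_waiting)
  have "Some k \<in> snd ` set (queue (restart t) (step (first t) s) m) \<longleftrightarrow>
      Some (Suc k) \<in> snd ` set (queue t s (Suc m))" for m
    unfolding queue_eq[symmetric] set_map image_image snd_map_prod
    by (force simp: image_iff f_eq eq_commute[of "Some k"] simp del: queue.simps)
  then have "Suc k \<le> m \<and> Some (Suc k) \<notin> snd ` set (queue t s (Suc m)) \<longleftrightarrow>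
      (\<exists>m'. m = Suc m' \<and> k \<le> m' \<and>
         Some k \<notin> snd ` set (queue (restart t) (step (first t) s) (Suc m')))" for m
    by (cases m) (simp_all del: queue.simps)
  then have "{m. Suc k \<le> m \<and> Some (Suc k) \<notin> snd ` set (queue t s (Suc m))} =
      Suc ` {m. k \<le> m \<and> Some k \<notin> snd ` set (queue (restart t) (step (first t) s) (Suc m))}"
    unfolding image_def by blast
  then show ?thesis
    unfolding waiting_time_def by (simp add: image_image player_time_Suc del: queue.simps)
qed

section \<open>Independent Poisson streams\<close>

instance ptype :: countable
  by countable_datatype

lemma UNIV_ptype: "UNIV = {TypeA, TypeB, TypeC}"
  using ptype.exhaust by auto

lemma sum_ptype: "(\<Sum>p\<in>UNIV. f p) = f TypeA + f TypeB + f TypeC"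
  by (simp add: UNIV_ptype add.assoc)

locale poisson_streams =
  fixes rate :: "ptype \<Rightarrow> real"
  assumes rate_pos: "0 < rate p"
begin

definition total :: real where
  "total = rate TypeA + rate TypeB + rate TypeC"

lemma total_pos: "0 < total"
  using rate_pos by (simp add: total_def add_pos_pos)

text \<open>The canonical law of all interarrival times. Working on the coordinate space allows
  single coordinates to be resampled; \<open>curry w\<close> recovers the path argument
  \<open>t\<close>.\<close>

definition streams :: "(ptype \<times> nat \<Rightarrow> real) measure" where
  "streams = PiM UNIV (\<lambda>i. exponential (rate (fst i)))"

lemma prob_space_exponential: "prob_space (exponential (rate p))"
  using rate_pos by (rule prob_space_exponential_density)

sublocale prob_space streams
  unfolding streams_def by (intro prob_space_PiM prob_space_exponential)

lemma sets_streams: "sets streams = sets (PiM UNIV (\<lambda>_. borel))"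
  unfolding streams_def by (rule sets_PiM_cong) auto

lemma space_streams [simp]: "space streams = UNIV"
  by (simp add: streams_def space_PiM)

lemma measurable_streamsI:
  assumes "\<And>i. (\<lambda>z. f z i) \<in> borel_measurable N"
  shows "f \<in> measurable N streams"
proof -
  have "f \<in> measurable N (PiM UNIV (\<lambda>_. borel))"
    by (rule measurable_PiM_single') (use assms in auto)
  then show ?thesis
    by (simp cong: measurable_cong_sets add: sets_streams)
qed

lemma measurable_stream_component [measurable]: "(\<lambda>w. w i) \<in> borel_measurable streams"
  using measurable_component_singleton[of i UNIV "\<lambda>_. borel"]
  by (simp cong: measurable_cong_sets add: sets_streams)

lemma measurable_stream_upd [measurable (raw)]:
  assumes [measurable]: "f \<in> measurable N streams" "g \<in> borel_measurable N"
  shows "(\<lambda>z. (f z)(i := g z)) \<in> measurable N streams"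
proof (rule measurable_streamsI)
  show "(\<lambda>z. ((f z)(i := g z)) j) \<in> borel_measurable N" for j
    by (cases "j = i") simp_all
qed

text \<open>\<open>restart\<close> with the winner as a fixed parameter. Measurability is immediate
  for each fixed \<open>p\<close>, and the random winner takes only finitely many values.\<close>

definition restart_at :: "ptype \<Rightarrow> (ptype \<times> nat \<Rightarrow> real) \<Rightarrow> ptype \<times> nat \<Rightarrow> real" where
  "restart_at p w = (\<lambda>(s, n). if s = p then w (p, Suc n)
     else if n = 0 then w (s, 0) - w (p, 0) else w (s, n))"

lemma measurable_restart_at [measurable]: "restart_at p \<in> measurable streams streams"
  by (rule measurable_streamsI) (auto simp: restart_at_def split: prod.split)

lemma resample:
  assumes "F \<in> borel_measurable streams"
  shows "(\<integral>\<^sup>+w. F w \<partial>streams) = (\<integral>\<^sup>+x. \<integral>\<^sup>+w. F (w(i := x)) \<partial>streams \<partial>exponential (rate (fst i)))"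
  using nn_integral_PiM_resample[of "\<lambda>i. exponential (rate (fst i))" F i] assms prob_space_exponential
  unfolding streams_def by simp

lemma AE_streams_nonneg: "AE w in streams. \<forall>p n. 0 \<le> w (p, n)"
proof -
  have "AE w in streams. 0 \<le> w i" for i
  proof -
    have "AE x in exponential (rate (fst i)). 0 \<le> x"
      by (subst AE_density) (auto simp: exponential_density_def)
    then show ?thesis
      unfolding streams_def
      by (intro AE_PiM_component prob_space_exponential) auto
  qed
  then have "AE w in streams. \<forall>i. 0 \<le> w i"
    by (subst AE_all_countable) simp
  then show ?thesis
    by eventually_elim blast
qed

text \<open>On the event that \<open>p\<close> wins, the winning time and the restarted streams are
  independent, the former exponential with the summed rate and the latter with the original law.
  Given the winning time \<open>x\<close>, the two losers survive with weights
  \<open>exp (- (rate q * x))\<close> and \<open>exp (- (rate r * x))\<close> and have fresh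
  residual times. \<open>Lq\<close> and \<open>Lr\<close> leave the tie-breaking open.\<close>

lemma nn_integral_race:
  fixes p q r :: ptype and Lq Lr :: "real \<Rightarrow> real \<Rightarrow> bool"
    and G :: "real \<Rightarrow> (ptype \<times> nat \<Rightarrow> real) \<Rightarrow> ennreal"
  assumes pqr: "p \<noteq> q" "p \<noteq> r" "q \<noteq> r"
    and Lq: "Lq = (<) \<or> Lq = (\<le>)"
    and Lr: "Lr = (<) \<or> Lr = (\<le>)"
    and G [measurable]: "(\<lambda>(x, w). G x w) \<in> borel_measurable (borel \<Otimes>\<^sub>M streams)"
  shows "(\<integral>\<^sup>+w. (if Lq (w (p, 0)) (w (q, 0)) \<and> Lr (w (p, 0)) (w (r, 0))
              then G (w (p, 0)) (restart_at p w) else 0) \<partial>streams) =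
         ennreal (rate p / (rate p + rate q + rate r)) *
           (\<integral>\<^sup>+x. \<integral>\<^sup>+w. G x w \<partial>streams \<partial>exponential (rate p + rate q + rate r))"
proof -
  let ?P = "(p, 0) :: ptype \<times> nat"
  let ?Q = "(q, 0) :: ptype \<times> nat"
  let ?R = "(r, 0) :: ptype \<times> nat"
  define F where "F w = (if Lq (w ?P) (w ?Q) \<and> Lr (w ?P) (w ?R)
              then G (w ?P) (restart_at p w) else 0)" for w
  have less: "Measurable.pred (borel \<Otimes>\<^sub>M borel) (\<lambda>(x, y :: real). x < y)"
    and le: "Measurable.pred (borel \<Otimes>\<^sub>M borel) (\<lambda>(x, y :: real). x \<le> y)"
    by measurable
  have [measurable]: "Measurable.pred (borel \<Otimes>\<^sub>M borel) (\<lambda>(x, y). Lq x y)"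
    by (rule disjE[OF Lq]) (simp_all only: less le)
  have [measurable]: "Measurable.pred (borel \<Otimes>\<^sub>M borel) (\<lambda>(x, y). Lr x y)"
    by (rule disjE[OF Lr]) (simp_all only: less le)
  have Lq': "x < y \<Longrightarrow> Lq x y" "Lq x y \<Longrightarrow> x \<le> y" for x y
    using Lq by auto
  have Lr': "x < y \<Longrightarrow> Lr x y" "Lr x y \<Longrightarrow> x \<le> y" for x y
    using Lr by auto
  have F [measurable]: "F \<in> borel_measurable streams"
    unfolding F_def by measurable
  \<comment> \<open>Shifts the stream of \<open>p\<close> only; the restarted streams are
    \<open>w\<close> read through \<open>\<sigma>\<close>, with the first entries of
    \<open>q\<close> and \<open>r\<close> overwritten by residual times.\<close>
  define \<sigma> :: "ptype \<times> nat \<Rightarrow> ptype \<times> nat" where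
    "\<sigma> = (\<lambda>(s, n). if s = p then (s, Suc n) else (s, n))"
  have [measurable]: "(\<lambda>w i. w (\<sigma> i)) \<in> measurable streams streams"
    by (rule measurable_streamsI) simp
  \<comment> \<open>\<open>y\<close> and \<open>z\<close> are the residual first entries of
    \<open>q\<close> and \<open>r\<close>; all other coordinates are already integrated out.\<close>
  define K where
    "K x y z = (\<integral>\<^sup>+w. G x ((\<lambda>i. w (\<sigma> i))(?R := z, ?Q := y)) \<partial>streams)" for x y z
  have [measurable]: "(\<lambda>(x, y, z). K x y z) \<in> borel_measurable (borel \<Otimes>\<^sub>M borel \<Otimes>\<^sub>M borel)"
    unfolding K_def by measurable
  interpret Er: prob_space "exponential (rate r)"
    by (rule prob_space_exponential)
  define L where "L x y = (\<integral>\<^sup>+z. K x y z \<partial>exponential (rate r))" for x y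
  have [measurable]: "L x \<in> borel_measurable borel" for x
    unfolding L_def by (rule Er.borel_measurable_nn_integral) measurable
  define J where "J x = (\<integral>\<^sup>+w. G x w \<partial>streams)" for x
  have [measurable]: "J \<in> borel_measurable borel"
    unfolding J_def by measurable
  \<comment> \<open>Integrating the residual times against their exponential laws restores the full
    product law: the shift is undone by reindexing, the two overwritten entries by resampling
    backwards.\<close>
  have L_total: "(\<integral>\<^sup>+y. L x y \<partial>exponential (rate q)) = J x" for x
  proof -
    have "K x y z = (\<integral>\<^sup>+w. G x (w(?R := z, ?Q := y)) \<partial>streams)" for y z
    proof -
      have "(\<lambda>w. G x (w(?R := z, ?Q := y))) \<in> borel_measurable streams"
        by measurable
      then show ?thesis
        unfolding K_def streams_def
        by (rule nn_integral_PiM_reindex[where f = \<sigma>, OF prob_space_exponential, rotated 2])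
           (auto simp: inj_def \<sigma>_def split: if_splits)
    qed
    then have "(\<integral>\<^sup>+y. L x y \<partial>exponential (rate q)) =
        (\<integral>\<^sup>+y. \<integral>\<^sup>+w. G x (w(?Q := y)) \<partial>streams \<partial>exponential (rate q))"
      using resample[where F = "\<lambda>w. G x (w(?Q := y))" and i = ?R for y] by (simp add: L_def)
    also have "\<dots> = J x"
      using resample[where F = "\<lambda>w. G x w" and i = ?Q] by (simp add: J_def)
    finally show ?thesis .
  qed
  have F_upd: "F (w(?R := z, ?Q := y, ?P := x)) =
      (if Lr x z then if Lq x y
         then G x ((\<lambda>i. w (\<sigma> i))(?R := z - x, ?Q := y - x)) else 0 else 0)" for w x y z
  proof -
    have "restart_at p (w(?R := z, ?Q := y, ?P := x)) =
        (\<lambda>i. w (\<sigma> i))(?R := z - x, ?Q := y - x)"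
    proof (intro ext, clarify)
      fix s n
      have "s = p \<or> s = q \<or> s = r"
        using pqr by (cases s; cases p; cases q; cases r) auto
      then show "restart_at p (w(?R := z, ?Q := y, ?P := x)) (s, n) =
          ((\<lambda>i. w (\<sigma> i))(?R := z - x, ?Q := y - x)) (s, n)"
        using pqr by (auto simp: restart_at_def \<sigma>_def)
    qed
    then show ?thesis
      using pqr by (simp add: F_def)
  qed
  have "(\<integral>\<^sup>+w. F w \<partial>streams) =
      (\<integral>\<^sup>+x. \<integral>\<^sup>+w. F (w(?P := x)) \<partial>streams \<partial>exponential (rate p))"
    using resample[OF F, of ?P] by simp
  also have "\<dots> = (\<integral>\<^sup>+x. \<integral>\<^sup>+y. \<integral>\<^sup>+w. F (w(?Q := y, ?P := x))
      \<partial>streams \<partial>exponential (rate q) \<partial>exponential (rate p))"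
    using resample[where F = "\<lambda>w. F (w(?P := x))" and i = ?Q for x] by simp
  also have "\<dots> = (\<integral>\<^sup>+x. \<integral>\<^sup>+y. \<integral>\<^sup>+z. \<integral>\<^sup>+w. F (w(?R := z, ?Q := y, ?P := x))
      \<partial>streams \<partial>exponential (rate r) \<partial>exponential (rate q) \<partial>exponential (rate p))"
    using resample[where F = "\<lambda>w. F (w(?Q := y, ?P := x))" and i = ?R for x y] by simp
  also have "\<dots> = (\<integral>\<^sup>+x. \<integral>\<^sup>+y. \<integral>\<^sup>+z.
      (if Lr x z then if Lq x y then K x (y - x) (z - x) else 0 else 0)
      \<partial>exponential (rate r) \<partial>exponential (rate q) \<partial>exponential (rate p))"
    unfolding F_upd K_def by (intro nn_integral_cong) simp
  \<comment> \<open>Memorylessness is applied with \<open>x\<close> fixed, first to the clock of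
    \<open>r\<close>, then to that of \<open>q\<close>.\<close>
  also have "\<dots> = (\<integral>\<^sup>+x. ennreal (exp (- (rate q * x))) * (ennreal (exp (- (rate r * x))) * J x)
      \<partial>exponential (rate p))"
  proof (rule nn_integral_cong_AE)
    have "AE x in exponential (rate p). 0 \<le> x"
      by (subst AE_density) (auto simp: exponential_density_def)
    then show "AE x in exponential (rate p). (\<integral>\<^sup>+y. \<integral>\<^sup>+z.
        (if Lr x z then if Lq x y then K x (y - x) (z - x) else 0 else 0)
        \<partial>exponential (rate r) \<partial>exponential (rate q)) =
      ennreal (exp (- (rate q * x))) * (ennreal (exp (- (rate r * x))) * J x)"
    proof eventually_elim
      fix x :: real assume x: "0 \<le> x"
      have "(\<integral>\<^sup>+z. (if Lr x z then if Lq x y then K x (y - x) (z - x) else 0 else 0)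
          \<partial>exponential (rate r)) =
        ennreal (exp (- (rate r * x))) *
          (\<integral>\<^sup>+z. (if Lq x y then K x (y - x) z else 0) \<partial>exponential (rate r))" for y
        by (rule nn_integral_exponential_memoryless[OF rate_pos x _ Lr',
              where h = "\<lambda>z. if Lq x y then K x (y - x) z else 0"]) measurable
      also have "\<dots> y = (if Lq x y then ennreal (exp (- (rate r * x))) * L x (y - x) else 0)" for y
        by (simp add: L_def)
      finally have "(\<integral>\<^sup>+y. \<integral>\<^sup>+z.
          (if Lr x z then if Lq x y then K x (y - x) (z - x) else 0 else 0)
          \<partial>exponential (rate r) \<partial>exponential (rate q)) =
        (\<integral>\<^sup>+y. (if Lq x y then ennreal (exp (- (rate r * x))) * L x (y - x) else 0)
          \<partial>exponential (rate q))"
        by simp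
      also have "\<dots> = ennreal (exp (- (rate q * x))) *
          (\<integral>\<^sup>+y. ennreal (exp (- (rate r * x))) * L x y \<partial>exponential (rate q))"
        by (rule nn_integral_exponential_memoryless[OF rate_pos x _ Lq',
              where h = "\<lambda>y. ennreal (exp (- (rate r * x))) * L x y"]) measurable
      also have "\<dots> = ennreal (exp (- (rate q * x))) * (ennreal (exp (- (rate r * x))) * J x)"
        by (subst nn_integral_cmult) (simp_all add: L_total)
      finally show "(\<integral>\<^sup>+y. \<integral>\<^sup>+z.
          (if Lr x z then if Lq x y then K x (y - x) (z - x) else 0 else 0)
          \<partial>exponential (rate r) \<partial>exponential (rate q)) =
        ennreal (exp (- (rate q * x))) * (ennreal (exp (- (rate r * x))) * J x)" .
    qed
  qed
  also have "\<dots> = (\<integral>\<^sup>+x. ennreal (exponential_density (rate p) x) *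
      (ennreal (exp (- (rate q * x))) * (ennreal (exp (- (rate r * x))) * J x)) \<partial>lborel)"
    by (subst nn_integral_density) auto
  also have "\<dots> = (\<integral>\<^sup>+x. ennreal (rate p / (rate p + rate q + rate r)) *
      (ennreal (exponential_density (rate p + rate q + rate r) x) * J x) \<partial>lborel)"
  proof (rule nn_integral_cong)
    fix x :: real
    let ?s = "rate p + rate q + rate r"
    have pos: "0 < rate p" "0 < ?s"
      using rate_pos by (simp_all add: add_pos_pos)
    \<comment> \<open>The density of the winner times both survival probabilities is the density of
      the minimum times the probability that \<open>p\<close> attains it.\<close>
    have "exponential_density (rate p) x * (exp (- (rate q * x)) * exp (- (rate r * x))) =
        rate p / ?s * exponential_density ?s x"
    proof -
      have "exp (- x * rate p) * (exp (- (rate q * x)) * exp (- (rate r * x))) = exp (- x * ?s)"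
        by (simp add: exp_add[symmetric] algebra_simps)
      then show ?thesis
        using pos by (simp add: exponential_density_def mult.assoc)
    qed
    then have "ennreal (exponential_density (rate p) x) *
        (ennreal (exp (- (rate q * x))) * ennreal (exp (- (rate r * x)))) =
        ennreal (rate p / ?s) * ennreal (exponential_density ?s x)"
      using pos by (simp add: ennreal_mult[symmetric] exponential_density_nonneg)
    then show "ennreal (exponential_density (rate p) x) *
        (ennreal (exp (- (rate q * x))) * (ennreal (exp (- (rate r * x))) * J x)) =
      ennreal (rate p / ?s) * (ennreal (exponential_density ?s x) * J x)"
      by (metis mult.assoc)
  qed
  also have "\<dots> = ennreal (rate p / (rate p + rate q + rate r)) *
      (\<integral>\<^sup>+x. ennreal (exponential_density (rate p + rate q + rate r) x) * J x \<partial>lborel)"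
    by (rule nn_integral_cmult) auto
  also have "(\<integral>\<^sup>+x. ennreal (exponential_density (rate p + rate q + rate r) x) * J x \<partial>lborel) =
      (\<integral>\<^sup>+x. J x \<partial>exponential (rate p + rate q + rate r))"
    by (subst nn_integral_density) auto
  finally show ?thesis
    unfolding F_def J_def .
qed

text \<open>Summing the race over its three possible winners gives the joint law of type, gap and
  restarted streams as a product.\<close>

lemma nn_integral_restart:
  fixes G :: "ptype \<Rightarrow> real \<Rightarrow> (ptype \<times> nat \<Rightarrow> real) \<Rightarrow> ennreal"
  assumes G [measurable]: "\<And>p. (\<lambda>(x, w). G p x w) \<in> borel_measurable (borel \<Otimes>\<^sub>M streams)"
  shows "(\<integral>\<^sup>+w. G (first (curry w)) (gap (curry w)) (case_prod (restart (curry w))) \<partial>streams) =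
    (\<Sum>p\<in>UNIV. ennreal (rate p / total) * (\<integral>\<^sup>+x. \<integral>\<^sup>+w. G p x w \<partial>streams \<partial>exponential total))"
proof -
  define R where "R p q r Lq Lr w = (if Lq (w (p, 0)) (w (q, 0)) \<and> Lr (w (p, 0)) (w (r, 0))
      then G p (w (p, 0)) (restart_at p w) else 0)"
    for p q r :: ptype and Lq Lr :: "real \<Rightarrow> real \<Rightarrow> bool" and w
  have [measurable]: "Measurable.pred streams (\<lambda>w. w i < w j)"
      "Measurable.pred streams (\<lambda>w. w i \<le> w j)" for i j
    using borel_measurable_less[OF measurable_stream_component[of i] measurable_stream_component[of j]]
      borel_measurable_le[OF measurable_stream_component[of i] measurable_stream_component[of j]]
    by (simp_all add: pred_def)
  have [measurable]: "R p q r (\<le>) (\<le>) \<in> borel_measurable streams"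
    "R p q r (<) (\<le>) \<in> borel_measurable streams"
    "R p q r (<) (<) \<in> borel_measurable streams" for p q r
    unfolding R_def by measurable
  have restart_eq: "case_prod (restart (curry w)) = restart_at (first (curry w)) w" for w
    by (auto simp: fun_eq_iff restart_def restart_at_def gap_def)
  \<comment> \<open>The strict and weak comparisons reproduce the tie-breaking of
    \<open>next_type\<close>, so for each \<open>w\<close> exactly one of the three conditions holds
    and no null set has to be removed.\<close>
  have "G (first (curry w)) (gap (curry w)) (case_prod (restart (curry w))) =
      R TypeA TypeB TypeC (\<le>) (\<le>) w + R TypeB TypeA TypeC (<) (\<le>) w + R TypeC TypeA TypeB (<) (<) w"
    for w
    unfolding restart_eq by (auto simp: R_def first_def' gap_def)
  then have "(\<integral>\<^sup>+w. G (first (curry w)) (gap (curry w)) (case_prod (restart (curry w))) \<partial>streams) =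
      (\<integral>\<^sup>+w. R TypeA TypeB TypeC (\<le>) (\<le>) w \<partial>streams) +
      (\<integral>\<^sup>+w. R TypeB TypeA TypeC (<) (\<le>) w \<partial>streams) +
      (\<integral>\<^sup>+w. R TypeC TypeA TypeB (<) (<) w \<partial>streams)"
    by (simp add: nn_integral_add)
  also have "(\<integral>\<^sup>+w. R TypeA TypeB TypeC (\<le>) (\<le>) w \<partial>streams) =
      ennreal (rate TypeA / total) * (\<integral>\<^sup>+x. \<integral>\<^sup>+w. G TypeA x w \<partial>streams \<partial>exponential total)"
    using nn_integral_race[OF _ _ _ _ _ G, of TypeA TypeB TypeC "(\<le>)" "(\<le>)" TypeA]
    by (simp add: R_def total_def)
  also have "(\<integral>\<^sup>+w. R TypeB TypeA TypeC (<) (\<le>) w \<partial>streams) =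
      ennreal (rate TypeB / total) * (\<integral>\<^sup>+x. \<integral>\<^sup>+w. G TypeB x w \<partial>streams \<partial>exponential total)"
    using nn_integral_race[OF _ _ _ _ _ G, of TypeB TypeA TypeC "(<)" "(\<le>)" TypeB]
    by (simp add: R_def total_def add.commute)
  also have "(\<integral>\<^sup>+w. R TypeC TypeA TypeB (<) (<) w \<partial>streams) =
      ennreal (rate TypeC / total) * (\<integral>\<^sup>+x. \<integral>\<^sup>+w. G TypeC x w \<partial>streams \<partial>exponential total)"
    using nn_integral_race[OF _ _ _ _ _ G, of TypeC TypeA TypeB "(<)" "(<)" TypeC]
    by (simp add: R_def total_def add_ac)
  finally show ?thesis
    unfolding sum_ptype .
qed

end

section \<open>A symmetric pair of affine relations over the extended reals\<close>

text \<open>Finiteness is essential, since \<open>\<top>\<close> satisfies both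
  inequalities.\<close>

lemma affine_pair_le:
  fixes x y :: ennreal and a c :: real
  assumes fin: "x < \<top>" "y < \<top>" and ac: "0 \<le> a" "0 \<le> c" "c < 1"
    and le: "x \<le> ennreal a + ennreal c * y" "y \<le> ennreal a + ennreal c * x"
  shows "x \<le> ennreal (a / (1 - c))"
proof -
  obtain u v where uv: "0 \<le> u" "x = ennreal u" "0 \<le> v" "y = ennreal v"
    using fin by (metis ennreal_cases less_irrefl)
  then have "u \<le> a + c * v" "v \<le> a + c * u"
    using le ac by (simp_all add: ennreal_mult[symmetric] ennreal_plus[symmetric] del: ennreal_plus)
  then have "u \<le> a + c * (a + c * u)"
    using ac mult_left_mono[of v "a + c * u" c] by linarith
  \<comment> \<open>Substituting one inequality into the other gives the factor
    \<open>1 - c * c\<close>; its factor \<open>1 + c\<close> cancels.\<close>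
  then have "(u * (1 - c)) * (1 + c) \<le> a * (1 + c)"
    by (simp add: algebra_simps)
  then have "u * (1 - c) \<le> a"
    using ac by (subst (asm) mult_le_cancel_right) auto
  then show ?thesis
    using ac uv by (simp add: pos_le_divide_eq ennreal_leI)
qed

lemma affine_pair_eq:
  fixes x y :: ennreal and a c :: real
  assumes fin: "x < \<top>" "y < \<top>" and ac: "0 \<le> a" "0 \<le> c" "c < 1"
    and eq: "x = ennreal a + ennreal c * y" "y = ennreal a + ennreal c * x"
  shows "x = ennreal (a / (1 - c))"
proof -
  obtain u v where uv: "0 \<le> u" "x = ennreal u" "0 \<le> v" "y = ennreal v"
    using fin by (metis ennreal_cases less_irrefl)
  have "ennreal v = ennreal (a + c * u)"
    using eq(2) ac uv by (simp add: ennreal_mult)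
  then have v: "v = a + c * u"
    using ac uv by (subst (asm) ennreal_inj) simp_all
  have "ennreal u = ennreal (a + c * v)"
    using eq(1) ac uv by (simp add: ennreal_mult)
  then have "u = a + c * v"
    using ac uv by (subst (asm) ennreal_inj) simp_all
  then have "(u * (1 - c)) * (1 + c) = a * (1 + c)"
    unfolding v by (simp add: algebra_simps)
  then have "u * (1 - c) = a"
    using ac by simp
  then show ?thesis
    using ac uv by (simp add: eq_divide_eq)
qed

section \<open>Measurability of types, times, queues and waits on the stream space\<close>

context poisson_streams
begin

lemma restart_curry: "restart (curry w) = curry (restart_at (first (curry w)) w)"
  by (auto simp: fun_eq_iff restart_def restart_at_def gap_def)

lemma measurable_first [measurable]:
  "(\<lambda>w. first (curry w)) \<in> measurable streams (count_space UNIV)"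
proof -
  have [measurable]: "Measurable.pred streams (\<lambda>w. w i \<le> w j)" for i j
    using borel_measurable_le[OF measurable_stream_component[of i] measurable_stream_component[of j]]
    by (simp add: pred_def)
  show ?thesis
    unfolding first_def' curry_conv by measurable
qed

lemma gap_curry: "gap (curry w) = w (first (curry w), 0)"
  by (simp add: gap_def)

lemma measurable_gap [measurable]: "(\<lambda>w. gap (curry w)) \<in> borel_measurable streams"
  unfolding gap_curry
  by (rule measurable_compose_countable[where f = "\<lambda>p w. w (p, 0)", OF _ measurable_first]) simp

lemma measurable_restart [measurable]:
  "(\<lambda>w. restart_at (first (curry w)) w) \<in> measurable streams streams"
  by (rule measurable_compose_countable[where f = restart_at, OF _ measurable_first]) simp

lemma measurable_player_type [measurable]:
  "(\<lambda>w. player_type (curry w) k) \<in> measurable streams (count_space UNIV)"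
proof (induction k)
  case 0
  show ?case unfolding player_type_0 by measurable
next
  case (Suc k)
  from measurable_compose[OF measurable_restart Suc] show ?case
    unfolding player_type_Suc restart_curry .
qed

lemma measurable_player_time [measurable]:
  "(\<lambda>w. player_time (curry w) k) \<in> borel_measurable streams"
proof (induction k)
  case 0
  show ?case unfolding player_time_0 by measurable
next
  case (Suc k)
  note [measurable] = measurable_compose[OF measurable_restart Suc]
  show ?case
    unfolding player_time_Suc restart_curry by measurable
qed

text \<open>Queues over countable labels form a countable type, so the previous queue can be fixed
  to each of its values in turn.\<close>

lemma measurable_queue_from:
  fixes q :: "(ptype \<times> 'i :: countable) list"
  shows "(\<lambda>w. queue_from (curry w) l q k) \<in> measurable streams (count_space UNIV)"
proof (induction k)
  case (Suc k)
  have "(\<lambda>w. admit (player_type (curry w) k, l k) q') \<in> measurable streams (count_space UNIV)" for q'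
    by (rule measurable_compose[OF measurable_player_type]) simp
  then show ?case
    unfolding queue_from.simps
    by (rule measurable_compose_countable[
          where f = "\<lambda>q' w. admit (player_type (curry w) k, l k) q'", OF _ Suc])
qed simp

lemma pred_queue_from:
  fixes q :: "(ptype \<times> 'i :: countable) list"
  shows "Measurable.pred streams (\<lambda>w. P (queue_from (curry w) l q k))"
  by (rule measurable_compose[OF measurable_queue_from]) simp

lemma measurable_residual [measurable]: "(\<lambda>w. residual (curry w) q) \<in> borel_measurable streams"
proof -
  note pred_queue_from[measurable]
  show ?thesis
    unfolding residual_def by measurable
qed

lemma measurable_waiting_time [measurable]:
  "(\<lambda>w. waiting_time (curry w) s k) \<in> borel_measurable streams"
proof -
  note pred_queue_from[measurable]
  show ?thesis
    unfolding waiting_time_def INF_Collect_eq queue_eq_queue_from by measurable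
qed


section \<open>Mean residual times\<close>

definition mean_residual :: "ennreal \<Rightarrow> (ptype \<times> bool) list \<Rightarrow> ennreal" where
  "mean_residual N q = (\<integral>\<^sup>+w. inf (residual (curry w) q) N \<partial>streams)"

lemma sum_rate: "(\<Sum>p\<in>UNIV. ennreal (rate p / total)) = 1"
proof -
  have "(\<Sum>p\<in>UNIV. ennreal (rate p / total)) = ennreal (\<Sum>p\<in>UNIV. rate p / total)"
    using rate_pos total_pos by (intro sum_ennreal) (simp add: less_imp_le)
  also have "(\<Sum>p\<in>UNIV. rate p / total) = 1"
    using total_pos by (simp add: sum_ptype total_def add_divide_distrib[symmetric])
  finally show ?thesis by simp
qed

lemma nn_integral_total_add:
  "(\<integral>\<^sup>+x. \<integral>\<^sup>+w. ennreal x + f w \<partial>streams \<partial>exponential total) =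
     ennreal (1 / total) + (\<integral>\<^sup>+w. f w \<partial>streams)" if [measurable]: "f \<in> borel_measurable streams"
proof -
  interpret E: prob_space "exponential total"
    using total_pos by (rule prob_space_exponential_density)
  have "(\<integral>\<^sup>+x. \<integral>\<^sup>+w. ennreal x + f w \<partial>streams \<partial>exponential total) =
      (\<integral>\<^sup>+x. ennreal x + (\<integral>\<^sup>+w. f w \<partial>streams) \<partial>exponential total)"
    by (simp add: nn_integral_add emeasure_space_1[simplified])
  also have "\<dots> = ennreal (1 / total) + (\<integral>\<^sup>+w. f w \<partial>streams)"
    using total_pos E.emeasure_space_1
    by (subst nn_integral_add) (simp_all add: nn_integral_exponential_ident)
  finally show ?thesis .
qed

text \<open>The first gap has mean \<open>1 / total\<close> whichever type arrives, hence it
  separates from the sum over that type.\<close>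

lemma nn_integral_gap_add:
  assumes [measurable]: "\<And>p. f p \<in> borel_measurable streams"
  shows "(\<integral>\<^sup>+w. ennreal (gap (curry w)) + f (first (curry w)) (restart_at (first (curry w)) w) \<partial>streams) =
     ennreal (1 / total) + (\<Sum>p\<in>UNIV. ennreal (rate p / total) * (\<integral>\<^sup>+w. f p w \<partial>streams))"
proof -
  have "case_prod (restart (curry w)) = restart_at (first (curry w)) w" for w
    unfolding restart_curry by simp
  then have "(\<integral>\<^sup>+w. ennreal (gap (curry w)) + f (first (curry w)) (restart_at (first (curry w)) w) \<partial>streams) =
      (\<Sum>p\<in>UNIV. ennreal (rate p / total) *
        (\<integral>\<^sup>+x. \<integral>\<^sup>+w. ennreal x + f p w \<partial>streams \<partial>exponential total))"
    using nn_integral_restart[of "\<lambda>p x w. ennreal x + f p w"] by simp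
  also have "\<dots> = (\<Sum>p\<in>UNIV. ennreal (rate p / total) *
      (ennreal (1 / total) + (\<integral>\<^sup>+w. f p w \<partial>streams)))"
    by (simp only: nn_integral_total_add assms)
  also have "\<dots> = ennreal (1 / total) + (\<Sum>p\<in>UNIV. ennreal (rate p / total) * (\<integral>\<^sup>+w. f p w \<partial>streams))"
    unfolding distrib_left sum.distrib sum_distrib_right[symmetric] sum_rate by simp
  finally show ?thesis .
qed

lemma nn_integral_first:
  assumes [measurable]: "\<And>p. f p \<in> borel_measurable streams"
  shows "(\<integral>\<^sup>+w. f (first (curry w)) (restart_at (first (curry w)) w) \<partial>streams) =
     (\<Sum>p\<in>UNIV. ennreal (rate p / total) * (\<integral>\<^sup>+w. f p w \<partial>streams))"
proof -
  interpret E: prob_space "exponential total"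
    using total_pos by (rule prob_space_exponential_density)
  have "case_prod (restart (curry w)) = restart_at (first (curry w)) w" for w
    unfolding restart_curry by simp
  then show ?thesis
    using nn_integral_restart[of "\<lambda>p x w. f p w"] E.emeasure_space_1 by simp
qed

lemma residual_curry_rec:
  assumes "\<forall>p n. 0 \<le> w (p, n)" and "marked q"
  shows "residual (curry w) q = ennreal (gap (curry w)) +
    residual (curry (restart_at (first (curry w)) w)) (admit (first (curry w), False) q)"
  using residual_rec[of "curry w" q] assms unfolding restart_curry by simp

text \<open>Capping does not commute with adding the gap; only
  \<open>inf (x + r) N \<le> x + inf r N\<close> holds. An upper bound is all that the finiteness
  argument needs.\<close>

lemma mean_residual_rec_le:
  assumes "marked q"
  shows "mean_residual N q \<le> ennreal (1 / total) +
    (\<Sum>p\<in>UNIV. ennreal (rate p / total) * mean_residual N (admit (p, False) q))"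
proof -
  have inf_add: "inf (x + r) N \<le> x + inf r N" for x r :: ennreal
  proof (cases "r \<le> N")
    case True
    then show ?thesis by (simp add: inf_absorb1)
  next
    case False
    then have "inf r N = N" by (simp add: inf_absorb2)
    moreover have "N \<le> x + N" by (rule add_increasing) simp_all
    ultimately show ?thesis by (simp add: le_infI2)
  qed
  have "mean_residual N q \<le> (\<integral>\<^sup>+w. ennreal (gap (curry w)) +
      inf (residual (curry (restart_at (first (curry w)) w)) (admit (first (curry w), False) q)) N \<partial>streams)"
    unfolding mean_residual_def using AE_streams_nonneg
    by (intro nn_integral_mono_AE, eventually_elim) (simp add: residual_curry_rec assms inf_add)
  then show ?thesis
    unfolding mean_residual_def
    by (subst (asm) nn_integral_gap_add[of "\<lambda>p w. inf (residual (curry w) (admit (p, False) q)) N"]) simp_all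
qed

lemma mean_residual_rec:
  assumes "marked q"
  shows "mean_residual \<top> q = ennreal (1 / total) +
    (\<Sum>p\<in>UNIV. ennreal (rate p / total) * mean_residual \<top> (admit (p, False) q))"
proof -
  have "mean_residual \<top> q = (\<integral>\<^sup>+w. ennreal (gap (curry w)) +
      residual (curry (restart_at (first (curry w)) w)) (admit (first (curry w), False) q) \<partial>streams)"
    unfolding mean_residual_def using AE_streams_nonneg
    by (intro nn_integral_cong_AE, eventually_elim) (simp add: residual_curry_rec assms)
  then show ?thesis
    unfolding mean_residual_def
    by (subst (asm) nn_integral_gap_add[of "\<lambda>p w. residual (curry w) (admit (p, False) q)"]) simp_all
qed

lemma mean_residual_unmarked: "\<not> marked q \<Longrightarrow> mean_residual N q = 0"
  by (simp add: mean_residual_def residual_def inf_absorb1)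

lemma mean_residual_le: "mean_residual N q \<le> N"
proof -
  have "mean_residual N q \<le> (\<integral>\<^sup>+w. N \<partial>streams)"
    unfolding mean_residual_def by (rule nn_integral_mono) simp
  then show ?thesis
    using emeasure_space_1 by simp
qed

text \<open>Monotone convergence carries a bound uniform in the finite caps over to the uncapped
  mean.\<close>

lemma mean_residual_SUP: "mean_residual \<top> q = (SUP n. mean_residual (of_nat n) q)"
proof -
  have "(SUP n. mean_residual (of_nat n) q) =
      (\<integral>\<^sup>+w. (SUP n. inf (residual (curry w) q) (of_nat n)) \<partial>streams)"
    unfolding mean_residual_def
    by (intro nn_integral_monotone_convergence_SUP[symmetric])
       (auto simp: incseq_def le_fun_def intro: le_infI2)
  also have "\<dots> = mean_residual \<top> q"
    unfolding mean_residual_def inf_SUP[symmetric] ennreal_SUP_of_nat_eq_top ..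
  finally show ?thesis ..
qed

lemma mean_residual_TypeC: "mean_residual \<top> [(TypeC, True)] = ennreal (1 / total)"
  by (subst mean_residual_rec) (simp_all add: marked_def can_match_def sum_ptype mean_residual_unmarked)

text \<open>An arrival of type \<open>q\<close> merely toggles between \<open>p\<close> alone and
  \<open>p\<close> followed by \<open>q\<close>, while types \<open>p\<close> and
  \<open>TypeC\<close> match the marked player. The two mean residual times therefore satisfy the
  same affine relation with the roles exchanged. With \<open>q\<close> in front, an arrival of type
  \<open>p\<close> ends the wait, and the other two types bring the marked player to the
  front.\<close>

lemma mean_residual_zone:
  assumes pq: "p \<noteq> q" "p \<noteq> TypeC" "q \<noteq> TypeC"
  shows mean_residual_head: "mean_residual \<top> [(p, True)] = ennreal (1 / (rate p + rate TypeC))"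
    and mean_residual_behind: "mean_residual \<top> [(q, False), (p, True)] =
          ennreal ((1 + (rate q + rate TypeC) / (rate p + rate TypeC)) / total)"
proof -
  let ?a = "1 / total" and ?c = "rate q / total"
  have sum_pq: "(\<Sum>s\<in>UNIV. f s) = f p + f q + f TypeC" for f :: "ptype \<Rightarrow> ennreal"
    using pq by (cases p; cases q) (auto simp: sum_ptype add.commute)
  have total: "total = rate p + rate q + rate TypeC"
    using pq by (cases p; cases q) (auto simp: total_def)
  have pos: "0 < rate p" "0 < rate q" "0 < rate TypeC"
    using rate_pos by simp_all
  have match: "can_match p p" "can_match TypeC p" "can_match TypeC q" "can_match q q"
      "\<not> can_match p q" "\<not> can_match q p"
    using pq by (cases p; cases q; simp add: can_match_def)+
  have ac: "0 \<le> ?a" "0 \<le> ?c" "?c < 1"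
    using pos by (simp_all add: total)
  define X where "X N = mean_residual N [(p, True)]" for N
  define Y where "Y N = mean_residual N [(p, True), (q, False)]" for N
  have X_le: "X N \<le> ennreal ?a + ennreal ?c * Y N" for N
    using mean_residual_rec_le[of "[(p, True)]" N]
    by (simp add: X_def Y_def marked_def sum_pq match mean_residual_unmarked)
  have Y_le: "Y N \<le> ennreal ?a + ennreal ?c * X N" for N
    using mean_residual_rec_le[of "[(p, True), (q, False)]" N]
    by (simp add: X_def Y_def marked_def sum_pq match mean_residual_unmarked)
  have fin: "X (of_nat n) < \<top>" "Y (of_nat n) < \<top>" for n
    using mean_residual_le[of "of_nat n"] of_nat_less_top[of n]
    unfolding X_def Y_def by (meson le_less_trans)+
  \<comment> \<open>The bound does not depend on the cap, so it survives the supremum and rules out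
    \<open>\<top>\<close>.\<close>
  have "X \<top> \<le> ennreal (?a / (1 - ?c))"
    unfolding X_def mean_residual_SUP
    using affine_pair_le[OF fin ac X_le Y_le] by (auto simp: X_def intro: SUP_least)
  then have X_fin: "X \<top> < \<top>"
    by (rule le_less_trans) simp
  have "Y \<top> \<le> ennreal (?a / (1 - ?c))"
    unfolding Y_def mean_residual_SUP
    using affine_pair_le[OF fin(2) fin(1) ac Y_le X_le] by (auto simp: Y_def intro: SUP_least)
  then have Y_fin: "Y \<top> < \<top>"
    by (rule le_less_trans) simp
  have "X \<top> = ennreal (?a / (1 - ?c))"
  proof (rule affine_pair_eq[OF X_fin Y_fin ac])
    show "X \<top> = ennreal ?a + ennreal ?c * Y \<top>"
      using mean_residual_rec[of "[(p, True)]"]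
      by (simp add: X_def Y_def marked_def sum_pq match mean_residual_unmarked)
    show "Y \<top> = ennreal ?a + ennreal ?c * X \<top>"
      using mean_residual_rec[of "[(p, True), (q, False)]"]
      by (simp add: X_def Y_def marked_def sum_pq match mean_residual_unmarked)
  qed
  also have "?a / (1 - ?c) = 1 / (rate p + rate TypeC)"
    using pos by (simp add: total field_simps)
  finally show head: "mean_residual \<top> [(p, True)] = ennreal (1 / (rate p + rate TypeC))"
    by (simp add: X_def)
  have "mean_residual \<top> [(q, False), (p, True)] = ennreal ?a +
      (ennreal (rate q / total) * ennreal (1 / (rate p + rate TypeC)) +
       ennreal (rate TypeC / total) * ennreal (1 / (rate p + rate TypeC)))"
    by (subst mean_residual_rec)
       (simp_all add: marked_def sum_pq match mean_residual_unmarked head)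
  also have "\<dots> = ennreal (?a + (rate q / total * (1 / (rate p + rate TypeC)) +
      rate TypeC / total * (1 / (rate p + rate TypeC))))"
    using pos ac by (simp add: total ennreal_mult[symmetric] ennreal_plus[symmetric] del: ennreal_plus)
  also have "?a + (rate q / total * (1 / (rate p + rate TypeC)) +
      rate TypeC / total * (1 / (rate p + rate TypeC))) =
      (1 + (rate q + rate TypeC) / (rate p + rate TypeC)) / total"
    by (simp add: add_divide_distrib mult.commute)
  finally show "mean_residual \<top> [(q, False), (p, True)] =
      ennreal ((1 + (rate q + rate TypeC) / (rate p + rate TypeC)) / total)" .
qed

end

section \<open>Stationarity seen by the arriving players\<close>

lemma UNIV_state: "UNIV = {S0, SA, SB, SC, SAB, SBA}"
  using state.exhaust by auto

instance state :: finite
  by standard (simp add: UNIV_state)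

lemma sum_state: "(\<Sum>s\<in>UNIV. f s) = f S0 + f SA + f SB + f SC + f SAB + f SBA"
  by (simp add: UNIV_state add.assoc)

context poisson_streams
begin

text \<open>An integral over the type event, not normalised by its probability, so that it
  decomposes linearly over the first arrival.\<close>

definition weighted_wait :: "state \<Rightarrow> ptype \<Rightarrow> nat \<Rightarrow> ennreal" where
  "weighted_wait s p k =
     (\<integral>\<^sup>+w. (if player_type (curry w) k = p then waiting_time (curry w) s k else 0) \<partial>streams)"

lemma measurable_player_type_eq [measurable]:
  "Measurable.pred streams (\<lambda>w. player_type (curry w) k = p)"
  by (rule measurable_compose[OF measurable_player_type]) simp

lemma weighted_wait_Suc:
  "weighted_wait s p (Suc k) =
     (\<Sum>q\<in>UNIV. ennreal (rate q / total) * weighted_wait (step q s) p k)"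
  unfolding weighted_wait_def player_type_Suc waiting_time_Suc restart_curry
  by (rule nn_integral_first[where f = "\<lambda>q w. if player_type (curry w) k = p
        then waiting_time (curry w) (step q s) k else 0"]) measurable

lemma weighted_wait_0:
  "weighted_wait s p 0 = ennreal (rate p / total) *
     mean_residual \<top> (admit (p, True) (map (\<lambda>p. (p, False)) (waiting s)))"
proof -
  let ?f = "\<lambda>q w. if q = p
    then residual (curry w) (admit (q, True) (map (\<lambda>p. (p, False)) (waiting s))) else 0"
  have "weighted_wait s p 0 = (\<integral>\<^sup>+w. ?f (first (curry w)) (restart_at (first (curry w)) w) \<partial>streams)"
    unfolding weighted_wait_def player_type_0 waiting_time_0 restart_curry ..
  also have "\<dots> = (\<Sum>q\<in>UNIV. ennreal (rate q / total) * (\<integral>\<^sup>+w. ?f q w \<partial>streams))"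
    by (rule nn_integral_first) measurable
  also have "\<dots> = ennreal (rate p / total) * (\<integral>\<^sup>+w. ?f p w \<partial>streams)"
    by (cases p) (simp_all add: sum_ptype)
  finally show ?thesis
    by (simp add: mean_residual_def)
qed

text \<open>Player \<open>k + 1\<close> is player \<open>k\<close> of the restarted streams, whose
  law is unchanged by the type of the first arrival; so all players have the type law of the
  first.\<close>

lemma emeasure_player_type:
  "emeasure streams {w. player_type (curry w) k = p} = ennreal (rate p / total)"
proof -
  have "(\<integral>\<^sup>+w. indicator {w. player_type (curry w) k = p} w \<partial>streams) = ennreal (rate p / total)"
  proof (induction k)
    case 0
    have "(\<integral>\<^sup>+w. indicator {w. first (curry w) = p} w \<partial>streams) =
        (\<integral>\<^sup>+w. (\<lambda>q w. indicator {p} q) (first (curry w)) (restart_at (first (curry w)) w) \<partial>streams)"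
      by (intro nn_integral_cong) (simp split: split_indicator)
    also have "\<dots> = (\<Sum>q\<in>UNIV. ennreal (rate q / total) *
        (\<integral>\<^sup>+w. indicator {p} q \<partial>streams))"
      by (rule nn_integral_first) measurable
    also have "\<dots> = ennreal (rate p / total)"
      using emeasure_space_1 by (cases p) (simp_all add: sum_ptype)
    finally show ?case
      unfolding player_type_0 .
  next
    case (Suc k)
    have "(\<integral>\<^sup>+w. indicator {w. player_type (curry w) (Suc k) = p} w \<partial>streams) =
        (\<integral>\<^sup>+w. (\<lambda>q w. indicator {w. player_type (curry w) k = p} w)
          (first (curry w)) (restart_at (first (curry w)) w) \<partial>streams)"
      unfolding player_type_Suc restart_curry
      by (intro nn_integral_cong) (simp split: split_indicator)
    also have "\<dots> = (\<Sum>q\<in>UNIV. ennreal (rate q / total) *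
        (\<integral>\<^sup>+w. indicator {w. player_type (curry w) k = p} w \<partial>streams))"
      by (rule nn_integral_first) measurable
    also have "\<dots> = ennreal (rate p / total)"
      unfolding Suc sum_distrib_right[symmetric] sum_rate by simp
    finally show ?case .
  qed
  then show ?thesis
    using measurable_player_type_eq[of k p] by (simp add: pred_def)
qed

end

text \<open>Each arrival changes the state and the exit rate is \<open>total\<close> everywhere. The
  balance equations divided by \<open>total\<close> thus say that \<open>\<pi>\<close> is invariant
  under one arrival; the test function \<open>h\<close> puts this in the form of the recursion for
  \<open>weighted_wait\<close>.\<close>

lemma (in poisson_streams) stationary_step:
  fixes h :: "state \<Rightarrow> ennreal"
  assumes "stationary_distribution (rate TypeA) (rate TypeB) (rate TypeC) \<pi>"
  shows "(\<Sum>s\<in>UNIV. ennreal (pmf \<pi> s) * (\<Sum>q\<in>UNIV. ennreal (rate q / total) * h (step q s))) =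
    (\<Sum>s\<in>UNIV. ennreal (pmf \<pi> s) * h s)"
proof -
  have inflow: "(\<Sum>s\<in>UNIV. \<Sum>q\<in>UNIV. if step q s = y then pmf \<pi> s * (rate q / total) else 0) = pmf \<pi> y"
    for y
  proof -
    have "total * (\<Sum>s\<in>UNIV. \<Sum>q\<in>UNIV. if step q s = y then pmf \<pi> s * (rate q / total) else 0) =
        (\<Sum>s\<in>UNIV. \<Sum>q\<in>UNIV. if step q s = y then pmf \<pi> s * rate q else 0)"
      using total_pos by (simp add: sum_distrib_left if_distrib cong: if_cong)
    also have "\<dots> = total * pmf \<pi> y"
      \<comment> \<open>For each target \<open>y\<close>, the rates of the types leading to
        \<open>y\<close> add up to the entries of the rate table.\<close>
      using assms[unfolded stationary_distribution_def, rule_format, of y]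
      by (cases y) (simp_all add: sum_state sum_ptype total_def algebra_simps)
    finally show ?thesis
      using total_pos by simp
  qed
  have "(\<Sum>s\<in>UNIV. ennreal (pmf \<pi> s) * (\<Sum>q\<in>UNIV. ennreal (rate q / total) * h (step q s))) =
      (\<Sum>s\<in>UNIV. \<Sum>q\<in>UNIV. \<Sum>y\<in>UNIV.
        ennreal (if step q s = y then pmf \<pi> s * (rate q / total) else 0) * h y)"
  proof -
    have "(\<Sum>y\<in>UNIV. ennreal (if step q s = y then pmf \<pi> s * (rate q / total) else 0) * h y) =
        ennreal (pmf \<pi> s) * (ennreal (rate q / total) * h (step q s))" for s q
    proof -
      have "(\<Sum>y\<in>UNIV. ennreal (if step q s = y then pmf \<pi> s * (rate q / total) else 0) * h y) =
          (\<Sum>y\<in>UNIV. if step q s = y then ennreal (pmf \<pi> s * (rate q / total)) * h y else 0)"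
        by (intro sum.cong) auto
      also have "\<dots> = ennreal (pmf \<pi> s * (rate q / total)) * h (step q s)"
        by simp
      also have "ennreal (pmf \<pi> s * (rate q / total)) = ennreal (pmf \<pi> s) * ennreal (rate q / total)"
        using rate_pos total_pos by (intro ennreal_mult) (simp_all add: less_imp_le)
      finally show ?thesis
        by (simp only: mult.assoc)
    qed
    then show ?thesis
      by (simp add: sum_distrib_left)
  qed
  also have "\<dots> = (\<Sum>s\<in>UNIV. \<Sum>y\<in>UNIV. \<Sum>q\<in>UNIV.
        ennreal (if step q s = y then pmf \<pi> s * (rate q / total) else 0) * h y)"
    by (intro sum.cong refl sum.swap)
  also have "\<dots> = (\<Sum>y\<in>UNIV. \<Sum>s\<in>UNIV. \<Sum>q\<in>UNIV.
        ennreal (if step q s = y then pmf \<pi> s * (rate q / total) else 0) * h y)"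
    by (rule sum.swap)
  also have "\<dots> = (\<Sum>y\<in>UNIV. ennreal (\<Sum>s\<in>UNIV. \<Sum>q\<in>UNIV.
        if step q s = y then pmf \<pi> s * (rate q / total) else 0) * h y)"
    using rate_pos total_pos
    by (simp add: sum_distrib_right[symmetric] sum_ennreal sum_nonneg less_imp_le)
  finally show ?thesis
    unfolding inflow .
qed

lemma (in poisson_streams) stationary_weighted_wait:
  assumes "stationary_distribution (rate TypeA) (rate TypeB) (rate TypeC) \<pi>"
  shows "(\<Sum>s\<in>UNIV. ennreal (pmf \<pi> s) * weighted_wait s p k) =
    ennreal (rate p / total) * (\<Sum>s\<in>UNIV. ennreal (pmf \<pi> s) *
      mean_residual \<top> (admit (p, True) (map (\<lambda>p. (p, False)) (waiting s))))"
proof (induction k)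
  case 0
  show ?case
    by (simp add: weighted_wait_0 sum_distrib_left mult.left_commute)
next
  case (Suc k)
  then show ?case
    unfolding weighted_wait_Suc
    using stationary_step[OF assms, of "\<lambda>s. weighted_wait s p k"] by simp
qed

text \<open>Eliminating the two-player states from the balance equations leaves a homogeneous system
  for \<open>u\<close> and \<open>v\<close>, the defects of the two claimed identities. Its
  determinant is positive.\<close>

lemma stationary_one_waiting:
  assumes pos: "0 < lA" "0 < lB" "0 < lC"
    and st: "stationary_distribution lA lB lC \<pi>"
  shows "pmf \<pi> SA = lA / (lA + lC) * pmf \<pi> S0" "pmf \<pi> SB = lB / (lB + lC) * pmf \<pi> S0"
proof -
  let ?l = "lA + lB + lC"
  define u where "u = pmf \<pi> SA * (lA + lC) - pmf \<pi> S0 * lA"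
  define v where "v = pmf \<pi> SB * (lB + lC) - pmf \<pi> S0 * lB"
  note balance = st[unfolded stationary_distribution_def, rule_format]
  have SA: "pmf \<pi> S0 * lA + pmf \<pi> SAB * lB + pmf \<pi> SBA * (lB + lC) = pmf \<pi> SA * ?l"
    and SB: "pmf \<pi> S0 * lB + pmf \<pi> SAB * (lA + lC) + pmf \<pi> SBA * lA = pmf \<pi> SB * ?l"
    and SAB: "pmf \<pi> SA * lB = pmf \<pi> SAB * ?l"
    and SBA: "pmf \<pi> SB * lA = pmf \<pi> SBA * ?l"
    using balance[of SA] balance[of SB] balance[of SAB] balance[of SBA]
    by (simp_all add: sum_state algebra_simps)
  \<comment> \<open>Multiplying \<open>SB\<close> by the total rate and inserting \<open>SAB\<close>
    and \<open>SBA\<close> produces \<open>?l\<^sup>2 - lA\<^sup>2\<close>, whose factor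
    \<open>?l - lA\<close> is \<open>lB + lC\<close>.\<close>
  have v: "(?l + lA) * v = lB * u"
    using SB SAB SBA unfolding u_def v_def by algebra
  have u: "(?l + lB) * u = lA * v"
    using SA SAB SBA unfolding u_def v_def by algebra
  have "((?l + lA) * (?l + lB) - lA * lB) * v = 0"
    using u v by algebra
  moreover have "0 < (?l + lA) * (?l + lB) - lA * lB"
    using pos by (simp add: algebra_simps add_pos_pos)
  ultimately have "v = 0" by simp
  then have "u = 0" using u pos by simp
  show "pmf \<pi> SA = lA / (lA + lC) * pmf \<pi> S0" "pmf \<pi> SB = lB / (lB + lC) * pmf \<pi> S0"
    using \<open>u = 0\<close> \<open>v = 0\<close> pos unfolding u_def v_def by (simp_all add: field_simps)
qed

section \<open>Transfer from the canonical streams to the given probability space\<close>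

sublocale stationary_matchmaking \<subseteq> P: poisson_streams "arrival_rate lA lB lC"
proof
  show "0 < arrival_rate lA lB lC p" for p
    using rates_pos by (cases p) simp_all
qed

context stationary_matchmaking
begin

abbreviation interarrivals :: "'w \<Rightarrow> ptype \<times> nat \<Rightarrow> real" where
  "interarrivals \<omega> \<equiv> (\<lambda>(p, n). \<tau> p n \<omega>)"

lemma curry_interarrivals: "curry (interarrivals \<omega>) = (\<lambda>p n. \<tau> p n \<omega>)"
  by (simp add: fun_eq_iff)

lemma measurable_tau: "\<tau> p n \<in> borel_measurable M"
  using distributed_measurable[OF exponential[of p n]] by simp

lemma measurable_interarrivals_PiM: "interarrivals \<in> measurable M (PiM UNIV (\<lambda>_. borel))"
  by (rule measurable_PiM_single') (auto simp: measurable_tau split: prod.split)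

lemma measurable_interarrivals [measurable]: "interarrivals \<in> measurable M P.streams"
  using measurable_interarrivals_PiM by (simp cong: measurable_cong_sets add: P.sets_streams)

lemma distr_interarrivals: "distr M (PiM UNIV (\<lambda>_. borel)) interarrivals = P.streams"
proof -
  have "distr M (PiM UNIV (\<lambda>_. borel)) (\<lambda>\<omega>. \<lambda>i\<in>UNIV. (case i of (p, n) \<Rightarrow> \<tau> p n) \<omega>) =
      PiM UNIV (\<lambda>i. distr M borel (case i of (p, n) \<Rightarrow> \<tau> p n))"
    using indep_interarrival
    by (subst (asm) indep_vars_iff_distr_eq_PiM') (auto simp: measurable_tau)
  moreover have "(\<lambda>\<omega>. \<lambda>i\<in>UNIV. (case i of (p, n) \<Rightarrow> \<tau> p n) \<omega>) = interarrivals"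
    by (auto simp: fun_eq_iff)
  moreover have "distr M borel (case i of (p, n) \<Rightarrow> \<tau> p n) =
      exponential (arrival_rate lA lB lC (fst i))" for i
  proof -
    have "distr M borel (\<tau> p n) = distr M lborel (\<tau> p n)" for p n
      by (rule distr_cong) simp_all
    then show ?thesis
      using distributed_distr_eq_density[OF exponential] by (simp split: prod.split)
  qed
  ultimately show ?thesis
    by (simp add: P.streams_def)
qed

lemma measurable_X0_interarrivals:
  assumes "\<And>s. \<Phi> s \<in> borel_measurable P.streams"
  shows "(\<lambda>\<omega>. \<Phi> (X0 \<omega>) (interarrivals \<omega>)) \<in> borel_measurable M"
  by (rule measurable_compose_countable[where f = "\<lambda>s \<omega>. \<Phi> s (interarrivals \<omega>)", OF _ X0_measurable])
     (rule measurable_compose[OF measurable_interarrivals assms])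

text \<open>Independence makes the joint law of initial state and streams a product, checked on
  rectangles; the state space being finite, the outer integral is a sum.\<close>

lemma nn_integral_X0_interarrivals:
  assumes \<Phi>: "\<And>s. \<Phi> s \<in> borel_measurable P.streams"
  shows "(\<integral>\<^sup>+\<omega>. \<Phi> (X0 \<omega>) (interarrivals \<omega>) \<partial>M) =
    (\<Sum>s\<in>UNIV. ennreal (pmf \<pi> s) * (\<integral>\<^sup>+w. \<Phi> s w \<partial>P.streams))"
proof -
  let ?T = "PiM (UNIV :: (ptype \<times> nat) set) (\<lambda>_. borel :: real measure)"
  have \<Phi>_T: "\<Phi> s \<in> borel_measurable ?T" for s
    using \<Phi>[of s] by (simp cong: measurable_cong_sets add: P.sets_streams)
  have \<Phi>_pair: "(\<lambda>z. \<Phi> (fst z) (snd z)) \<in> borel_measurable (count_space UNIV \<Otimes>\<^sub>M ?T)"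
    by (rule measurable_compose_countable[where f = "\<lambda>s z. \<Phi> s (snd z)" and g = fst])
       (auto intro: measurable_compose[OF measurable_snd \<Phi>_T])
  have pair [measurable]:
    "(\<lambda>\<omega>. (X0 \<omega>, interarrivals \<omega>)) \<in> measurable M (count_space UNIV \<Otimes>\<^sub>M ?T)"
    using X0_measurable measurable_interarrivals_PiM by (rule measurable_Pair)
  have sets_eq: "sets (measure_pmf \<pi> \<Otimes>\<^sub>M P.streams) = sets (count_space UNIV \<Otimes>\<^sub>M ?T)"
    by (intro sets_pair_measure_cong) (simp_all add: P.sets_streams)
  have J: "measure_pmf \<pi> \<Otimes>\<^sub>M P.streams =
      distr M (count_space UNIV \<Otimes>\<^sub>M ?T) (\<lambda>\<omega>. (X0 \<omega>, interarrivals \<omega>))"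
  proof (rule pair_measure_eqI)
    show "sigma_finite_measure (measure_pmf \<pi>)" "sigma_finite_measure P.streams"
      by (rule measure_pmf.sigma_finite_measure_axioms P.sigma_finite_measure_axioms)+
    show "sets (measure_pmf \<pi> \<Otimes>\<^sub>M P.streams) =
        sets (distr M (count_space UNIV \<Otimes>\<^sub>M ?T) (\<lambda>\<omega>. (X0 \<omega>, interarrivals \<omega>)))"
      by (simp add: sets_eq)
    fix A B assume "A \<in> sets (measure_pmf \<pi>)" and "B \<in> sets P.streams"
    then have B: "B \<in> sets ?T"
      by (simp add: P.sets_streams)
    let ?XA = "X0 -` A \<inter> space M" and ?YB = "interarrivals -` B \<inter> space M"
    have "prob (?XA \<inter> ?YB) = prob ?XA * prob ?YB"
      using B by (intro indep_setD[OF indep_initial] in_vimage_algebra) simp_all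
    then have "emeasure M (?XA \<inter> ?YB) = emeasure M ?XA * emeasure M ?YB"
      by (simp add: emeasure_eq_measure ennreal_mult)
    moreover have "emeasure M ?XA = emeasure (measure_pmf \<pi>) A"
      unfolding X0_distr[symmetric] using X0_measurable by (simp add: emeasure_distr)
    moreover have "emeasure M ?YB = emeasure P.streams B"
      unfolding distr_interarrivals[symmetric] using measurable_interarrivals_PiM B
      by (simp add: emeasure_distr)
    moreover have "emeasure (distr M (count_space UNIV \<Otimes>\<^sub>M ?T) (\<lambda>\<omega>. (X0 \<omega>, interarrivals \<omega>))) (A \<times> B) =
        emeasure M (?XA \<inter> ?YB)"
      using B by (subst emeasure_distr[OF pair]) (auto intro!: arg_cong[where f = "emeasure M"])
    ultimately show "emeasure (measure_pmf \<pi>) A * emeasure P.streams B =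
        emeasure (distr M (count_space UNIV \<Otimes>\<^sub>M ?T) (\<lambda>\<omega>. (X0 \<omega>, interarrivals \<omega>))) (A \<times> B)"
      by simp
  qed
  have "(\<integral>\<^sup>+\<omega>. \<Phi> (X0 \<omega>) (interarrivals \<omega>) \<partial>M) =
      (\<integral>\<^sup>+z. \<Phi> (fst z) (snd z) \<partial>distr M (count_space UNIV \<Otimes>\<^sub>M ?T) (\<lambda>\<omega>. (X0 \<omega>, interarrivals \<omega>)))"
    by (subst nn_integral_distr[OF pair]) (simp_all add: \<Phi>_pair)
  also have "\<dots> = (\<integral>\<^sup>+s. \<integral>\<^sup>+w. \<Phi> s w \<partial>P.streams \<partial>measure_pmf \<pi>)"
  proof -
    have "(\<lambda>z. \<Phi> (fst z) (snd z)) \<in> borel_measurable (measure_pmf \<pi> \<Otimes>\<^sub>M P.streams)"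
      using \<Phi>_pair sets_eq by (simp cong: measurable_cong_sets)
    from P.nn_integral_fst[OF this] show ?thesis
      unfolding J by simp
  qed
  also have "\<dots> = (\<Sum>s\<in>UNIV. ennreal (pmf \<pi> s) * (\<integral>\<^sup>+w. \<Phi> s w \<partial>P.streams))"
    by (simp add: nn_integral_measure_pmf nn_integral_count_space_finite)
  finally show ?thesis .
qed

lemma emeasure_type:
  "emeasure M {\<omega> \<in> space M. player_type (\<lambda>p n. \<tau> p n \<omega>) k = p} =
     ennreal (arrival_rate lA lB lC p / P.total)"
proof -
  have "{w. player_type (curry w) k = p} \<in> sets P.streams"
    using P.measurable_player_type_eq[of k p] by (simp add: pred_def)
  then have A: "{w. player_type (curry w) k = p} \<in> sets (PiM UNIV (\<lambda>_. borel))"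
    by (simp only: P.sets_streams)
  have "{\<omega> \<in> space M. player_type (\<lambda>p n. \<tau> p n \<omega>) k = p} =
      interarrivals -` {w. player_type (curry w) k = p} \<inter> space M"
    unfolding vimage_def mem_Collect_eq curry_interarrivals by blast
  then show ?thesis
    using P.emeasure_player_type[of k p] emeasure_distr[OF measurable_interarrivals_PiM A]
    unfolding distr_interarrivals by simp
qed

lemma nn_integral_wait_of:
  "(\<integral>\<^sup>+\<omega>. (if player_type (\<lambda>p n. \<tau> p n \<omega>) k = p
        then waiting_time (\<lambda>p n. \<tau> p n \<omega>) (X0 \<omega>) k else 0) \<partial>M) =
    ennreal (arrival_rate lA lB lC p / P.total) * (\<Sum>s\<in>UNIV. ennreal (pmf \<pi> s) *
      P.mean_residual \<top> (admit (p, True) (map (\<lambda>p. (p, False)) (waiting s))))"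
proof -
  have "(\<integral>\<^sup>+\<omega>. (if player_type (curry (interarrivals \<omega>)) k = p
        then waiting_time (curry (interarrivals \<omega>)) (X0 \<omega>) k else 0) \<partial>M) =
      (\<Sum>s\<in>UNIV. ennreal (pmf \<pi> s) * P.weighted_wait s p k)"
    unfolding P.weighted_wait_def
    by (rule nn_integral_X0_interarrivals[where \<Phi> = "\<lambda>s w. if player_type (curry w) k = p
          then waiting_time (curry w) s k else 0"]) measurable
  also have "\<dots> = ennreal (arrival_rate lA lB lC p / P.total) * (\<Sum>s\<in>UNIV. ennreal (pmf \<pi> s) *
      P.mean_residual \<top> (admit (p, True) (map (\<lambda>p. (p, False)) (waiting s))))"
    using stationary by (intro P.stationary_weighted_wait) simp
  finally show ?thesis
    unfolding curry_interarrivals .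
qed

lemma measurable_wait: "(\<lambda>\<omega>. waiting_time (\<lambda>p n. \<tau> p n \<omega>) (X0 \<omega>) k) \<in> borel_measurable M"
  using measurable_X0_interarrivals[of "\<lambda>s w. waiting_time (curry w) s k"]
  by (simp only: P.measurable_waiting_time curry_interarrivals)

lemma pred_type: "Measurable.pred M (\<lambda>\<omega>. player_type (\<lambda>p n. \<tau> p n \<omega>) k = p)"
  using measurable_compose[OF measurable_interarrivals P.measurable_player_type_eq[of k p]]
  by (simp only: curry_interarrivals)

text \<open>Conditioning divides by \<open>arrival_rate lA lB lC p / P.total\<close>, the very
  factor in \<open>nn_integral_wait_of\<close>. What remains is the mean residual time of a player
  finding the stationary state, the same for every \<open>k\<close>.\<close>

lemma mean_wait_of_eq:
  "mean_wait_of M X0 \<tau> p k = (\<Sum>s\<in>UNIV. ennreal (pmf \<pi> s) *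
     P.mean_residual \<top> (admit (p, True) (map (\<lambda>p. (p, False)) (waiting s))))"
    (is "_ = ?E")
proof -
  let ?S = "{\<omega> \<in> space M. player_type (\<lambda>p n. \<tau> p n \<omega>) k = p}"
  have "0 < arrival_rate lA lB lC p / P.total"
    using P.rate_pos P.total_pos by simp
  then have nonzero: "ennreal (arrival_rate lA lB lC p / P.total) \<noteq> 0"
    by (simp only: ennreal_eq_0_iff not_le not_False_eq_True)
  have "mean_wait_of M X0 \<tau> p k =
      (\<integral>\<^sup>+\<omega>. waiting_time (\<lambda>p n. \<tau> p n \<omega>) (X0 \<omega>) k * indicator ?S \<omega> \<partial>M) / emeasure M ?S"
    unfolding mean_wait_of_def
    using pred_type by (intro nn_integral_uniform_measure measurable_wait) (simp add: pred_def)
  also have "(\<integral>\<^sup>+\<omega>. waiting_time (\<lambda>p n. \<tau> p n \<omega>) (X0 \<omega>) k * indicator ?S \<omega> \<partial>M) =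
      (\<integral>\<^sup>+\<omega>. (if player_type (\<lambda>p n. \<tau> p n \<omega>) k = p
        then waiting_time (\<lambda>p n. \<tau> p n \<omega>) (X0 \<omega>) k else 0) \<partial>M)"
    by (intro nn_integral_cong) (simp split: split_indicator)
  also have "\<dots> = ?E * ennreal (arrival_rate lA lB lC p / P.total)"
    unfolding nn_integral_wait_of by (rule mult.commute)
  finally show ?thesis
    unfolding emeasure_type ennreal_mult_divide_eq[OF nonzero ennreal_neq_top] .
qed

lemma mean_wait_eq:
  "mean_wait M X0 \<tau> k = (\<Sum>p\<in>UNIV. ennreal (arrival_rate lA lB lC p / P.total) *
     mean_wait_of M X0 \<tau> p k)"
proof -
  note [measurable] = measurable_wait pred_type
  have "mean_wait M X0 \<tau> k = (\<integral>\<^sup>+\<omega>. (\<Sum>p\<in>UNIV. if player_type (\<lambda>p n. \<tau> p n \<omega>) k = p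
        then waiting_time (\<lambda>p n. \<tau> p n \<omega>) (X0 \<omega>) k else 0) \<partial>M)"
    unfolding mean_wait_def
  proof (rule nn_integral_cong)
    fix \<omega>
    show "waiting_time (\<lambda>p n. \<tau> p n \<omega>) (X0 \<omega>) k = (\<Sum>p\<in>UNIV.
        if player_type (\<lambda>p n. \<tau> p n \<omega>) k = p
        then waiting_time (\<lambda>p n. \<tau> p n \<omega>) (X0 \<omega>) k else 0)"
      by (cases "player_type (\<lambda>p n. \<tau> p n \<omega>) k") (simp_all add: sum_ptype)
  qed
  also have "\<dots> = (\<Sum>p\<in>UNIV. \<integral>\<^sup>+\<omega>. (if player_type (\<lambda>p n. \<tau> p n \<omega>) k = p
        then waiting_time (\<lambda>p n. \<tau> p n \<omega>) (X0 \<omega>) k else 0) \<partial>M)"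
    by (rule nn_integral_sum) measurable
  finally show ?thesis
    unfolding nn_integral_wait_of mean_wait_of_eq .
qed

end

section \<open>Evaluation of the means for the three types\<close>

theorem mainTheorem5:
  fixes M :: "'w measure"
    and lA lB lC :: real
    and \<pi> :: "state pmf"
    and X0 :: "'w \<Rightarrow> state"
    and \<tau> :: "ptype \<Rightarrow> nat \<Rightarrow> 'w \<Rightarrow> real"
    and k :: nat
  assumes "stationary_matchmaking M lA lB lC \<pi> X0 \<tau>"
  shows "mean_wait_of M X0 \<tau> TypeA k =
           ennreal ((2 * lA * lB + lA * lC + 2 * lB\<^sup>2 + 4 * lB * lC + lC\<^sup>2)
             / ((lA + lC) * (lB + lC) * (lA + lB + lC)) * pmf \<pi> S0)
       \<and> mean_wait_of M X0 \<tau> TypeB k =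
           ennreal ((2 * lA * lB + lB * lC + 2 * lA\<^sup>2 + 4 * lA * lC + lC\<^sup>2)
             / ((lA + lC) * (lB + lC) * (lA + lB + lC)) * pmf \<pi> S0)
       \<and> mean_wait_of M X0 \<tau> TypeC k = ennreal (pmf \<pi> S0 / (lA + lB + lC))
       \<and> mean_wait M X0 \<tau> k =
           (ennreal lA * mean_wait_of M X0 \<tau> TypeA k
             + ennreal lB * mean_wait_of M X0 \<tau> TypeB k
             + ennreal lC * mean_wait_of M X0 \<tau> TypeC k) / ennreal (lA + lB + lC)"
proof -
  interpret stationary_matchmaking M lA lB lC \<pi> X0 \<tau>
    by (rule assms)
  let ?l = "lA + lB + lC"
  note pos = rates_pos
  have l: "0 < ?l" "P.total = ?l"
    using pos by (simp_all add: P.total_def)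
  note residual = P.mean_residual_TypeC P.mean_residual_unmarked
    P.mean_residual_head[of TypeA TypeB] P.mean_residual_head[of TypeB TypeA]
    P.mean_residual_behind[of TypeA TypeB] P.mean_residual_behind[of TypeB TypeA]
  note one = stationary_one_waiting[OF pos stationary]
  have combine: "ennreal x * ennreal y + ennreal x' * ennreal y' = ennreal z"
    if "0 \<le> x" "0 \<le> y" "0 \<le> x'" "0 \<le> y'" "x * y + x' * y' = z" for x y x' y' z
    using that by (simp flip: ennreal_mult ennreal_plus)
  have A: "mean_wait_of M X0 \<tau> TypeA k =
      ennreal ((2 * lA * lB + lA * lC + 2 * lB\<^sup>2 + 4 * lB * lC + lC\<^sup>2)
        / ((lA + lC) * (lB + lC) * ?l) * pmf \<pi> S0)"
  proof -
    \<comment> \<open>In \<open>SA\<close>, \<open>SC\<close>, \<open>SAB\<close> and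
      \<open>SBA\<close> a type-A arrival is matched at once; in \<open>SB\<close> it queues behind
      the type-B player.\<close>
    have "mean_wait_of M X0 \<tau> TypeA k =
        ennreal (pmf \<pi> S0) * ennreal (1 / (lA + lC)) +
        ennreal (pmf \<pi> SB) * ennreal ((1 + (lB + lC) / (lA + lC)) / ?l)"
      unfolding mean_wait_of_eq
      by (simp add: sum_state can_match_def marked_def residual l)
    also have "\<dots> = ennreal ((2 * lA * lB + lA * lC + 2 * lB\<^sup>2 + 4 * lB * lC + lC\<^sup>2)
        / ((lA + lC) * (lB + lC) * ?l) * pmf \<pi> S0)"
    proof (rule combine)
      show "pmf \<pi> S0 * (1 / (lA + lC)) + pmf \<pi> SB * ((1 + (lB + lC) / (lA + lC)) / ?l) =
          (2 * lA * lB + lA * lC + 2 * lB\<^sup>2 + 4 * lB * lC + lC\<^sup>2)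
          / ((lA + lC) * (lB + lC) * ?l) * pmf \<pi> S0"
      proof -
        have "lA + lC \<noteq> 0" "lB + lC \<noteq> 0" "?l \<noteq> 0"
          using pos by simp_all
        then show ?thesis
          unfolding one by (simp add: divide_simps) algebra
      qed
    qed (use pos in simp_all)
    finally show ?thesis .
  qed
  have B: "mean_wait_of M X0 \<tau> TypeB k =
      ennreal ((2 * lA * lB + lB * lC + 2 * lA\<^sup>2 + 4 * lA * lC + lC\<^sup>2)
        / ((lA + lC) * (lB + lC) * ?l) * pmf \<pi> S0)"
  proof -
    have "mean_wait_of M X0 \<tau> TypeB k =
        ennreal (pmf \<pi> S0) * ennreal (1 / (lB + lC)) +
        ennreal (pmf \<pi> SA) * ennreal ((1 + (lA + lC) / (lB + lC)) / ?l)"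
      unfolding mean_wait_of_eq
      by (simp add: sum_state can_match_def marked_def residual l)
    also have "\<dots> = ennreal ((2 * lA * lB + lB * lC + 2 * lA\<^sup>2 + 4 * lA * lC + lC\<^sup>2)
        / ((lA + lC) * (lB + lC) * ?l) * pmf \<pi> S0)"
    proof (rule combine)
      show "pmf \<pi> S0 * (1 / (lB + lC)) + pmf \<pi> SA * ((1 + (lA + lC) / (lB + lC)) / ?l) =
          (2 * lA * lB + lB * lC + 2 * lA\<^sup>2 + 4 * lA * lC + lC\<^sup>2)
          / ((lA + lC) * (lB + lC) * ?l) * pmf \<pi> S0"
      proof -
        have "lA + lC \<noteq> 0" "lB + lC \<noteq> 0" "?l \<noteq> 0"
          using pos by simp_all
        then show ?thesis
          unfolding one by (simp add: divide_simps) algebra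
      qed
    qed (use pos in simp_all)
    finally show ?thesis .
  qed
  have C: "mean_wait_of M X0 \<tau> TypeC k = ennreal (pmf \<pi> S0 / ?l)"
  proof -
    \<comment> \<open>A choice-free player can play with anyone, so it waits only if it finds
      \<open>S0\<close>, and then exactly until the next arrival.\<close>
    have "mean_wait_of M X0 \<tau> TypeC k = ennreal (pmf \<pi> S0) * ennreal (1 / ?l)"
      unfolding mean_wait_of_eq
      by (simp add: sum_state can_match_def marked_def residual l)
    also have "\<dots> = ennreal (pmf \<pi> S0 / ?l)"
      using pos by (simp flip: ennreal_mult)
    finally show ?thesis .
  qed
  have scale: "ennreal (x / ?l) * y = ennreal x * y / ennreal ?l" if "0 < x" for x y
    using that l by (simp add: divide_ennreal[symmetric] ennreal_times_divide mult.commute)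
  have "mean_wait M X0 \<tau> k =
      (ennreal lA * mean_wait_of M X0 \<tau> TypeA k
        + ennreal lB * mean_wait_of M X0 \<tau> TypeB k
        + ennreal lC * mean_wait_of M X0 \<tau> TypeC k) / ennreal ?l"
    unfolding mean_wait_eq sum_ptype l arrival_rate.simps scale[OF pos(1)] scale[OF pos(2)]
      scale[OF pos(3)] add_divide_distrib_ennreal ..
  with A B C show ?thesis by blast
qed

end
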